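(* Let $1\le t\le n$ and let $H: a_1x_1+\cdots+a_tx_t=b$ be a spanned hyperplane of $Q_n$ ($a_i,b$ positive integers, $a_1\le\cdots\le a_t$) of type $\alpha=(\alpha_1,\dots,\alpha_\ell)$. Let $\delta(H)=1$ if $\sum_{i=1}^t a_i=2b$ and $\delta(H)=0$ otherwise. Then the cycle index of $F(H)$ acting on $V_n(H)$ is $$Z_H(z)=\frac{1}{2^{\delta(H)}}\sum_{(\mu^1,\ldots,\mu^\ell)}\prod_{i=1}^\ell z_{\mu^i}^{-1}\Big(Z_{n-t}(f_\mu(z))+\delta(H)\,Z_{n-t}(\overline{f}_\mu(z))\Big),$$ where the sum is over all tuples with $\mu^i$ a partition of $\alpha_i$ for each $i$, $\mu=(\mu^1,\dots,\mu^\ell)$, and the term with $\overline{f}_\mu$ is absent when $\delta(H)=0$.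
   Context: $Q_n=[0,1]^n$, $V_m=\{0,1\}^m$. $B_m$ is the group of signed permutations of $\{1,\dots,m\}$ (underlying permutation $\sigma$, sign $\pm$ on each element) acting by $w(x)_i=x_{\sigma(i)}$ (sign $+$) or $1-x_{\sigma(i)}$ (sign $-$). A spanned hyperplane of $Q_n$ is a hyperplane $H$ whose intersection with $V_n$ has affine hull $H$; $V_n(H)=H\cap V_n$; $F(H)=\{w\in B_n:w(H)=H\}$. For a finite group $G$ acting on a finite set $X$, the cycle index is $\frac{1}{|G|}\sum_{g\in G}\prod_i z_i^{c_i(g)}$, where $c_i(g)$ is the number of $i$-cycles of the permutation of $X$ induced by $g$. $Z_m(z)$ is the cycle index of $B_m$ acting on $V_m$ (with $Z_0(z)=z_1$), and $Z_{n-t}(f(z))$ means $Z_{n-t}$ with each $z_j$ replaced by $f(z_j)$. Type $\alpha$: $\ell=a_t$, $\alpha_i=\#\{j:a_j=i\}$, blocks $I_i=\{j:a_j=i\}$. $S_\alpha$: permutations of $\{1,\dots,t\}$ preserving each $I_i$ (signs $+$); $\overline{S}_\alpha$: signed permutations with underlying permutation in $S_\alpha$ and all signs $-$; $P(H)=S_\alpha$ if $\delta(H)=0$ and $S_\alpha\cup\overline{S}_\alpha$ if $\delta(H)=1$. For $\pi\in P(H)$, $\pi_i$ is its restriction to $I_i$. $V_t(H)=\{x\in\{0,1\}^t:\sum a_jx_j=b\}$ is permuted by each $\pi\in P(H)$; if this permutation has $m_i$ cycles of length $i$, put $f_\pi(z_j)=\prod_{i\ge1}(z_{\mathrm{lcm}(i,j)})^{ijm_i/\mathrm{lcm}(i,j)}$.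 For partitions $\mu^i\vdash\alpha_i$, $f_\mu$ (resp. $\overline{f}_\mu$, defined when $\delta(H)=1$) denotes $f_\pi$ for any $\pi\in S_\alpha$ (resp. $\pi\in\overline{S}_\alpha$) such that each $\pi_i$ has cycle type $\mu^i$ (this does not depend on the choice of $\pi$). For a partition $\lambda=\{1^{m_1},2^{m_2},\ldots\}$, $z_\lambda=\prod_i i^{m_i}m_i!$ (and $z_\lambda=1$ for the empty partition of $0$). *)

theory Defs
  imports
    "HOL-Analysis.Analysis"
    "HOL-Combinatorics.Orbits"
    "HOL-Combinatorics.Permutations"
    "HOL-Library.Function_Algebras"
    "HOL-Library.Multiset"
    "HOL-Library.Poly_Mapping"
begin

(* Pointwise vector space structure on functions; it makes the library notion
   "affine hull" available for points given as functions nat => real. *)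

instantiation "fun" :: (type, real_vector) real_vector
begin

definition scaleR_fun :: "real \<Rightarrow> ('a \<Rightarrow> 'b) \<Rightarrow> 'a \<Rightarrow> 'b" where
  "scaleR_fun c f = (\<lambda>x. c *\<^sub>R f x)"

instance
  by standard (simp_all add: scaleR_fun_def fun_eq_iff scaleR_add_right scaleR_add_left)

end

section \<open>Points, signed permutations and hyperplanes\<close>

(* A point of R^m is a function supported on the coordinates {1..m}. *)

definition space_R :: "nat \<Rightarrow> (nat \<Rightarrow> real) set" where
  "space_R m = {x. \<forall>i. i \<notin> {1..m} \<longrightarrow> x i = 0}"

definition cube_vertices :: "nat \<Rightarrow> (nat \<Rightarrow> real) set" where
  "cube_vertices m = {x \<in> space_R m. \<forall>i\<in>{1..m}. x i \<in> {0, 1}}"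

(* A signed permutation is a pair (p, N): the underlying permutation p of {1..m}
   and the set N of the elements carrying the sign -. *)

type_synonym signed_perm = "(nat \<Rightarrow> nat) \<times> nat set"

definition signed_perms :: "nat \<Rightarrow> signed_perm set" where
  "signed_perms m = {(p, N). p permutes {1..m} \<and> N \<subseteq> {1..m}}"

definition act :: "nat \<Rightarrow> signed_perm \<Rightarrow> (nat \<Rightarrow> real) \<Rightarrow> (nat \<Rightarrow> real)" where
  "act m w x = (\<lambda>i. if i \<in> {1..m}
                    then (if i \<in> snd w then 1 - x (fst w i) else x (fst w i))
                    else 0)"

definition is_hyperplane :: "nat \<Rightarrow> (nat \<Rightarrow> real) set \<Rightarrow> bool" where
  "is_hyperplane n H \<longleftrightarrow>
     (\<exists>c d. (\<exists>i\<in>{1..n}. c i \<noteq> 0) \<and> H = {x \<in> space_R n. (\<Sum>i=1..n. c i * x i) = d})"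

definition spanned_hyperplane :: "nat \<Rightarrow> (nat \<Rightarrow> real) set \<Rightarrow> bool" where
  "spanned_hyperplane n H \<longleftrightarrow> is_hyperplane n H \<and> affine hull (H \<inter> cube_vertices n) = H"

(* The points of R^m with a_1 x_1 + ... + a_t x_t = b; used with m = n for the
   hyperplane itself and with m = t for V_t(H). *)

definition hyperplane_of :: "nat \<Rightarrow> nat \<Rightarrow> (nat \<Rightarrow> nat) \<Rightarrow> nat \<Rightarrow> (nat \<Rightarrow> real) set" where
  "hyperplane_of m t a b = {x \<in> space_R m. (\<Sum>j=1..t. real (a j) * x j) = real b}"

definition hyperplane_stabilizer :: "nat \<Rightarrow> (nat \<Rightarrow> real) set \<Rightarrow> signed_perm set" where
  "hyperplane_stabilizer n H = {w \<in> signed_perms n. act n w ` H = H}"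

definition hyperplane_delta :: "nat \<Rightarrow> (nat \<Rightarrow> nat) \<Rightarrow> nat \<Rightarrow> nat" where
  "hyperplane_delta t a b = (if (\<Sum>j=1..t. a j) = 2 * b then 1 else 0)"

section \<open>Cycle indices\<close>

(* Rational polynomials in the variables z_0, z_1, z_2, ...: finitely supported
   maps from exponent vectors to coefficients. *)

type_synonym zpoly = "(nat \<Rightarrow>\<^sub>0 nat) \<Rightarrow>\<^sub>0 rat"

definition zconst :: "rat \<Rightarrow> zpoly" where
  "zconst c = Poly_Mapping.single 0 c"

definition zvar :: "nat \<Rightarrow> zpoly" where
  "zvar j = Poly_Mapping.single (Poly_Mapping.single j 1) 1"

(* zsubst p g replaces each variable z_j of p by the polynomial g j. *)

definition zsubst :: "zpoly \<Rightarrow> (nat \<Rightarrow> zpoly) \<Rightarrow> zpoly" where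
  "zsubst p g =
     (\<Sum>e\<in>Poly_Mapping.keys p.
        zconst (Poly_Mapping.lookup p e) *
        (\<Prod>j\<in>Poly_Mapping.keys e. g j ^ Poly_Mapping.lookup e j))"

(* Multiset of the cycle lengths of f on a finite set X that f permutes. *)

definition cycle_type :: "('a \<Rightarrow> 'a) \<Rightarrow> 'a set \<Rightarrow> nat multiset" where
  "cycle_type f X = image_mset card (mset_set (orbit f ` X))"

definition num_cycles :: "('a \<Rightarrow> 'a) \<Rightarrow> 'a set \<Rightarrow> nat \<Rightarrow> nat" where
  "num_cycles f X i = count (cycle_type f X) i"

(* Only the underlying set G of the group and its action enter the cycle index.
   No cycle on X is longer than card X, so the product is finite. *)

definition cycle_index :: "'g set \<Rightarrow> ('g \<Rightarrow> 'x \<Rightarrow> 'x) \<Rightarrow> 'x set \<Rightarrow> zpoly" where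
  "cycle_index G \<phi> X =
     zconst (1 / of_nat (card G)) *
     (\<Sum>g\<in>G. \<Prod>i=1..card X. zvar i ^ num_cycles (\<phi> g) X i)"

definition cube_cycle_index :: "nat \<Rightarrow> zpoly" where
  "cube_cycle_index m = cycle_index (signed_perms m) (act m) (cube_vertices m)"

section \<open>Partitions\<close>

definition partitions_of :: "nat \<Rightarrow> nat multiset set" where
  "partitions_of k = {\<mu>. 0 \<notin># \<mu> \<and> sum_mset \<mu> = k}"

definition z_partition :: "nat multiset \<Rightarrow> nat" where
  "z_partition \<mu> = (\<Prod>i\<in>set_mset \<mu>. i ^ count \<mu> i * fact (count \<mu> i))"

section \<open>The type of a hyperplane and the polynomials f\<close>

definition block :: "nat \<Rightarrow> (nat \<Rightarrow> nat) \<Rightarrow> nat \<Rightarrow> nat set" where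
  "block t a i = {j \<in> {1..t}. a j = i}"

definition type_of :: "nat \<Rightarrow> (nat \<Rightarrow> nat) \<Rightarrow> nat \<Rightarrow> nat" where
  "type_of t a i = card (block t a i)"

definition S_plus :: "nat \<Rightarrow> (nat \<Rightarrow> nat) \<Rightarrow> signed_perm set" where
  "S_plus t a = {(p, {}) | p. p permutes {1..t} \<and> (\<forall>i\<in>{1..a t}. p ` block t a i = block t a i)}"

definition S_minus :: "nat \<Rightarrow> (nat \<Rightarrow> nat) \<Rightarrow> signed_perm set" where
  "S_minus t a = {(p, {1..t}) | p. (p, {}) \<in> S_plus t a}"

definition has_type :: "nat \<Rightarrow> (nat \<Rightarrow> nat) \<Rightarrow> signed_perm \<Rightarrow> (nat \<Rightarrow> nat multiset) \<Rightarrow> bool" where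
  "has_type t a \<pi> \<mu> \<longleftrightarrow> (\<forall>i\<in>{1..a t}. cycle_type (fst \<pi>) (block t a i) = \<mu> i)"

(* f_perm t X \<pi> j is f_\<pi>(z_j), with X = V_t(H); the exponents are exact quotients. *)

definition f_perm :: "nat \<Rightarrow> (nat \<Rightarrow> real) set \<Rightarrow> signed_perm \<Rightarrow> nat \<Rightarrow> zpoly" where
  "f_perm t X \<pi> j =
     (\<Prod>i=1..card X. zvar (lcm i j) ^ ((i * j * num_cycles (act t \<pi>) X i) div lcm i j))"

(* f_\<mu> and its signed counterpart are f_\<pi> for an arbitrary \<pi> of cycle type \<mu>;
   the signed one is meaningful only if hyperplane_delta t a b = 1. *)

definition f_plus :: "nat \<Rightarrow> (nat \<Rightarrow> nat) \<Rightarrow> nat \<Rightarrow> (nat \<Rightarrow> nat multiset) \<Rightarrow> nat \<Rightarrow> zpoly" where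
  "f_plus t a b \<mu> =
     f_perm t (hyperplane_of t t a b \<inter> cube_vertices t) (SOME \<pi>. \<pi> \<in> S_plus t a \<and> has_type t a \<pi> \<mu>)"

definition f_minus :: "nat \<Rightarrow> (nat \<Rightarrow> nat) \<Rightarrow> nat \<Rightarrow> (nat \<Rightarrow> nat multiset) \<Rightarrow> nat \<Rightarrow> zpoly" where
  "f_minus t a b \<mu> =
     f_perm t (hyperplane_of t t a b \<inter> cube_vertices t) (SOME \<pi>. \<pi> \<in> S_minus t a \<and> has_type t a \<pi> \<mu>)"

end

theory Submission
  imports Defs
begin

text \<open>
  The points \<open>(b/a_1) e_1\<close> and \<open>((b - a_k)/a_1) e_1 + e_k\<close> determine the equation of \<open>H\<close> up to a
  factor \<open>c\<close>. A signed permutation maps \<open>H\<close> to itself iff it multiplies the equation by some \<open>c\<close>, and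
  comparing the sums of the absolute values of the coefficients gives \<open>c = 1\<close> or \<open>c = -1\<close>; the second
  case forces all signs on \<open>{1..t}\<close> to be negative and \<open>\<delta>(H) = 1\<close>. Hence \<open>F(H)\<close> is \<open>P(H) \<times> B_{n-t}\<close>, acting on
  \<open>V_t(H) \<times> V_{n-t}\<close>. A point \<open>(x, y)\<close> lies on a cycle of length the lcm of the cycle lengths of \<open>x\<close> and
  \<open>y\<close>, which turns the cycle monomial of a product into a substitution of \<open>f_\<pi>\<close>. Finally \<open>f_\<pi>\<close> depends
  only on the cycle types on the blocks, by conjugation inside \<open>S_\<alpha>\<close>, and \<open>\<alpha>_i! / z_\<mu>\<close> permutations of the
  \<open>i\<close>-th block have cycle type \<open>\<mu>\<close>.
\<close>

section \<open>Cycle types of permutations\<close>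

text \<open>Cycle types are developed for maps that are merely bijective on a finite set:
  \<open>act\<close> permutes a set of vertices but need not fix the other functions. Cycles are
  counted through their points, because pairs of points are easy to count, whereas a pair of cycles
  of lengths i and j splits into gcd(i, j) cycles of length lcm(i, j). With m_i cycles of length i
  this produces the exponent i j m_i / lcm(i, j) in f. The weights come from card P(H) = 2^\<delta>
  times the product of the \<alpha>_i!: on averaging, each factorial cancels against the \<alpha>_i!
  in the number of permutations of its block with a given cycle type, which leaves the inverse of
  z_\<mu> and the factor 1/2^\<delta>. The polynomials \<open>f_plus\<close> and
  \<open>f_minus\<close> are taken at an arbitrarily chosen representative, so conjugate elements of
  P(H) have to be shown to act with the same cycle type on V_t(H).\<close>

lemma orbit_perm_restrict_eq:
  assumes "bij_betw f X X" "x \<in> X"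
  shows "orbit f x = orbit (perm_restrict f X) x"
proof (rule orbit_cong0[OF assms(2)])
  show "f \<in> X \<rightarrow> X" using assms(1) by (auto simp: bij_betw_def)
qed (simp add: perm_restrict_simps)

lemma perm_restrict_permutes:
  assumes "bij_betw f X X"
  shows "perm_restrict f X permutes X"
proof (rule bij_imp_permutes)
  show "bij_betw (perm_restrict f X) X X"
    using assms by (subst bij_betw_cong[of X _ f]) (auto simp: perm_restrict_simps)
qed (simp add: perm_restrict_simps)

text \<open>Restricting \<open>f\<close> to X by \<open>perm_restrict\<close> gives a map that
  \<open>permutes\<close> X and has the same orbits from points of X, so the facts on orbits of
  permutations carry over to maps that are arbitrary outside X.\<close>

lemma orbit_bij_betw:
  assumes "bij_betw f X X" "finite X" "x \<in> X"
  shows orbit_bij_subset: "orbit f x \<subseteq> X"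
    and self_in_orbit_bij: "x \<in> orbit f x"
    and finite_orbit_bij: "finite (orbit f x)"
    and card_orbit_bij_pos: "0 < card (orbit f x)"
    and card_orbit_bij_le: "card (orbit f x) \<le> card X"
proof -
  let ?g = "perm_restrict f X"
  have g: "?g permutes X" by (rule perm_restrict_permutes[OF assms(1)])
  have eq: "orbit f x = orbit ?g x" by (rule orbit_perm_restrict_eq[OF assms(1,3)])
  show sub: "orbit f x \<subseteq> X" unfolding eq by (rule permutes_orbit_subset[OF g assms(3)])
  show self: "x \<in> orbit f x" unfolding eq
    using g assms(2) by (intro permutation_self_in_orbit) (auto simp: permutation_permutes)
  show fin: "finite (orbit f x)" using sub assms(2) by (rule finite_subset)
  show "0 < card (orbit f x)" using fin self by (auto simp: card_gt_0_iff)
  show "card (orbit f x) \<le> card X" using sub assms(2) by (rule card_mono[rotated])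
qed

lemma orbit_bij_eq:
  assumes "bij_betw f X X" "finite X" "x \<in> X" "y \<in> orbit f x"
  shows "orbit f y = orbit f x"
proof -
  have "x \<in> orbit f x" by (rule self_in_orbit_bij[OF assms(1-3)])
  then show ?thesis
    using assms(4) orbit_swap[of x f y] orbit_trans[of _ f] by blast
qed

text \<open>The return time \<open>funpow_dist1 f x x\<close> equals the size of the orbit, the
  iterates repeat with this period, and no smaller positive exponent returns to x. This turns cycle
  lengths into a matter of divisibility, the form needed for products of maps.\<close>

lemma funpow_fixed_iff_card_orbit_dvd:
  assumes "bij_betw f X X" "finite X" "x \<in> X"
  shows "(f ^^ k) x = x \<longleftrightarrow> card (orbit f x) dvd k"
proof -
  let ?N = "funpow_dist1 f x x"
  have self: "x \<in> orbit f x" by (rule self_in_orbit_bij[OF assms])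
  have card: "card (orbit f x) = ?N"
    by (subst orbit_conv_funpow_dist1[OF self])
      (simp add: card_image[OF inj_on_funpow_dist1[OF self]])
  have per: "(f ^^ ?N) x = x" by (rule funpow_dist1_prop[OF self])
  have red: "(f ^^ k) x = (f ^^ (k mod ?N)) x"
    using funpow_mod_eq[OF per, of k] by simp
  show ?thesis unfolding card
  proof
    assume "(f ^^ k) x = x"
    then have "(f ^^ (k mod ?N)) x = x" by (simp only: red)
    then have "\<not> (0 < k mod ?N)"
      using funpow_dist1_least[of "k mod ?N" f x x] by auto
    then show "?N dvd k" by (simp only: dvd_eq_mod_eq_0 neq0_conv[symmetric] not_not)
  next
    assume "?N dvd k"
    then have "k mod ?N = 0" by simp
    then show "(f ^^ k) x = x" by (simp only: red funpow_0)
  qed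
qed

lemma num_cycles_altdef:
  assumes "finite X"
  shows "num_cycles f X k = card {C \<in> orbit f ` X. card C = k}"
  using assms
  by (simp add: num_cycles_def cycle_type_def count_image_mset Int_def vimage_def conj_commute)

lemma card_Union_orbits:
  assumes "bij_betw f X X" "finite X" "K \<subseteq> orbit f ` X"
  shows "card (\<Union>K) = sum card K"
proof (rule card_Union_disjoint)
  show "pairwise disjnt K"
  proof (rule pairwiseI)
    fix C D assume "C \<in> K" "D \<in> K" "C \<noteq> D"
    then obtain x y where xy: "x \<in> X" "C = orbit f x" "y \<in> X" "D = orbit f y"
      using assms(3) by blast
    show "disjnt C D"
    proof (rule ccontr)
      assume "\<not> disjnt C D"
      then obtain z where "z \<in> orbit f x" "z \<in> orbit f y"
        unfolding disjnt_iff xy by blast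
      then have "orbit f x = orbit f y"
        using orbit_bij_eq[OF assms(1,2) xy(1)] orbit_bij_eq[OF assms(1,2) xy(3)] by metis
      with xy \<open>C \<noteq> D\<close> show False by simp
    qed
  qed
  show "finite C" if "C \<in> K" for C
    using that assms(3) finite_orbit_bij[OF assms(1,2)] by blast
qed

text \<open>Every cycle of length k carries k points, and distinct cycles are disjoint. Counting
  points in place of cycles is what makes products tractable: points of a product are just
  pairs.\<close>

lemma mult_num_cycles:
  assumes "bij_betw f X X" "finite X"
  shows "k * num_cycles f X k = card {x \<in> X. card (orbit f x) = k}"
proof -
  let ?K = "{C \<in> orbit f ` X. card C = k}"
  have "{x \<in> X. card (orbit f x) = k} = \<Union>?K" (is "?L = _")
  proof
    show "?L \<subseteq> \<Union>?K"
      using self_in_orbit_bij[OF assms] by blast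
    show "\<Union>?K \<subseteq> ?L"
    proof
      fix y assume "y \<in> \<Union>?K"
      then obtain x where x: "x \<in> X" "y \<in> orbit f x" "card (orbit f x) = k" by blast
      have "y \<in> X" using orbit_bij_subset[OF assms x(1)] x(2) by blast
      moreover have "orbit f y = orbit f x" by (rule orbit_bij_eq[OF assms x(1,2)])
      ultimately show "y \<in> ?L" using x(3) by simp
    qed
  qed
  moreover have "card (\<Union>?K) = sum card ?K"
    by (rule card_Union_orbits[OF assms]) blast
  ultimately show ?thesis
    by (simp add: num_cycles_altdef[OF assms(2)])
qed

lemma num_cycles_outside:
  assumes "bij_betw f X X" "finite X" "k \<notin> {1..card X}"
  shows "num_cycles f X k = 0"
proof -
  have "card C \<noteq> k" if C: "C \<in> orbit f ` X" for C
  proof -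
    from C obtain x where x: "x \<in> X" "C = orbit f x" by blast
    have "0 < card C" "card C \<le> card X"
      using card_orbit_bij_pos[OF assms(1,2) x(1)] card_orbit_bij_le[OF assms(1,2) x(1)]
      by (simp_all only: x(2))
    with assms(3) show ?thesis by auto
  qed
  then have "{C \<in> orbit f ` X. card C = k} = {}" by blast
  then show ?thesis by (simp add: num_cycles_altdef assms(2))
qed

text \<open>The map \<open>h\<close> carries the orbit of x bijectively onto the orbit of
  \<open>h x\<close>. Two different carrier sets are allowed so that the same fact serves
  conjugation within one set and transport along \<open>join\<close>.\<close>

lemma cycle_type_conj:
  assumes "bij_betw f X X" "finite X" "bij_betw h X Y" "\<And>x. x \<in> X \<Longrightarrow> g (h x) = h (f x)"
  shows "cycle_type g Y = cycle_type f X"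
proof -
  have orb: "orbit g (h x) = h ` orbit f x" if "x \<in> X" for x
    by (rule orbit_inverse[symmetric])
      (use that assms orbit_bij_subset[OF assms(1,2)] self_in_orbit_bij[OF assms(1,2)] in auto)
  have inj: "inj_on h X" and Y: "Y = h ` X" using assms(3) by (auto simp: bij_betw_def)
  have sub: "C \<subseteq> X" if "C \<in> orbit f ` X" for C
    using that orbit_bij_subset[OF assms(1,2)] by blast
  have "orbit g ` Y = (`) h ` (orbit f ` X)"
    using orb by (auto simp: Y image_image)
  moreover have "inj_on ((`) h) (orbit f ` X)"
    using sub inj by (meson inj_on_image_eq_iff inj_on_def)
  ultimately have "cycle_type g Y = image_mset (\<lambda>C. card (h ` C)) (mset_set (orbit f ` X))"
    by (simp add: cycle_type_def image_mset_mset_set[symmetric] multiset.map_comp comp_def)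
  also have "\<dots> = cycle_type f X"
    unfolding cycle_type_def
  proof (rule image_mset_cong)
    fix C assume "C \<in># mset_set (orbit f ` X)"
    then have "C \<subseteq> X" using sub assms(2) by simp
    then show "card (h ` C) = card C" using inj by (metis card_image inj_on_subset)
  qed
  finally show ?thesis .
qed

lemma cycle_type_cong:
  assumes "bij_betw f X X" "finite X" "\<And>x. x \<in> X \<Longrightarrow> g x = f x"
  shows "cycle_type g X = cycle_type f X"
  by (rule cycle_type_conj[OF assms(1,2), of id]) (use assms(3) in auto)

lemma sum_mset_cycle_type:
  assumes "bij_betw f X X" "finite X"
  shows "sum_mset (cycle_type f X) = card X"
proof -
  have "X = \<Union>(orbit f ` X)"
    using orbit_bij_subset[OF assms] self_in_orbit_bij[OF assms] by blast
  moreover have "card (\<Union>(orbit f ` X)) = sum card (orbit f ` X)"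
    by (rule card_Union_orbits[OF assms order_refl])
  ultimately show ?thesis
    by (simp add: cycle_type_def sum_unfold_sum_mset)
qed

lemma cycle_type_in_partitions_of:
  assumes "bij_betw f X X" "finite X"
  shows "cycle_type f X \<in> partitions_of (card X)"
proof -
  have "0 \<notin># cycle_type f X"
    using num_cycles_outside[OF assms, of 0] by (simp add: num_cycles_def not_in_iff)
  then show ?thesis by (simp add: partitions_of_def sum_mset_cycle_type[OF assms])
qed

lemma cycle_type_insert_fixed:
  assumes "q permutes B" "finite B" "a \<notin> B"
  shows "cycle_type q (insert a B) = add_mset 1 (cycle_type q B)"
proof -
  have "q a = a" using assms by (auto simp: permutes_not_in)
  then have orb: "orbit q a = {a}" by (simp add: orbit_eq_singleton_iff)
  have "{a} \<notin> orbit q ` B"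
    using permutes_orbit_subset[OF assms(1)] assms(3) by blast
  then show ?thesis using assms(2) by (simp add: cycle_type_def orb)
qed

text \<open>Composing with the transposition sends a to c and the element that \<open>q\<close> maps
  to c to a; elsewhere \<open>q\<close> is unchanged. So a is spliced into the cycle of c directly
  before c: that cycle grows by one and all other cycles stay.\<close>

lemma cycle_type_insert_transpose:
  assumes "q permutes B" "finite B" "a \<notin> B" "c \<in> B"
  shows "card (orbit q c) \<in># cycle_type q B"
    and "cycle_type (Transposition.transpose a c \<circ> q) (insert a B) =
      add_mset (Suc (card (orbit q c))) (cycle_type q B - {#card (orbit q c)#})"
proof -
  define p where "p = Transposition.transpose a c \<circ> q"
  have bij: "bij_betw q B B" by (rule permutes_imp_bij[OF assms(1)])
  have pp: "p permutes insert a B"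
    unfolding p_def
    using assms by (intro permutes_compose permutes_imp_permutes_insert permutes_swap_id) auto
  have bijp: "bij_betw p (insert a B) (insert a B)" by (rule permutes_imp_bij[OF pp])
  note obp = orbit_bij_betw[OF bijp finite.insertI[OF assms(2)]]
  note obq = orbit_bij_betw[OF bij assms(2)]
  have qa: "q a = a" using assms by (auto simp: permutes_not_in)
  have pa: "p a = c" by (simp add: p_def qa)
  have px: "p x = (if q x = c then a else q x)" if "x \<in> B" for x
    using that assms(1,3) by (auto simp: p_def Transposition.transpose_def permutes_in_image)
  let ?K = "insert a (orbit q c)"
  have sub: "orbit p a \<subseteq> ?K"
  proof
    fix y assume "y \<in> orbit p a"
    then show "y \<in> ?K"
    proof induct
      case base
      show ?case using obq(2)[OF assms(4)] by (simp add: pa)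
    next
      case (step y)
      have cin: "c \<in> ?K" using obq(2)[OF assms(4)] by (rule insertI2)
      from step(2) show ?case
      proof (rule insertE)
        assume "y = a"
        then show ?thesis using cin by (simp only: pa)
      next
        assume y: "y \<in> orbit q c"
        have py: "p y = (if q y = c then a else q y)"
          by (rule px) (rule subsetD[OF obq(1)[OF assms(4)] y])
        show ?thesis
          unfolding py using orbit.step[OF y] by (cases "q y = c") (simp_all only: simp_thms if_True if_False insertI1 insertI2)
      qed
    qed
  qed
  have aself: "a \<in> orbit p a" by (rule obp(2)) simp
  have "orbit q c \<subseteq> orbit p a"
  proof
    fix y assume "y \<in> orbit q c"
    then show "y \<in> orbit p a"
    proof induct
      case base
      show ?case
      proof (cases "q c = c")
        case True
        then show ?thesis using orbit.base[of p a] by (simp add: pa)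
      next
        case False
        then have "p c = q c" using px[OF assms(4)] by simp
        then show ?thesis using orbit.step[OF orbit.base, of p a] by (simp add: pa)
      qed
    next
      case (step y)
      then have "y \<in> B" using obq(1)[OF assms(4)] by blast
      show ?case
      proof (cases "q y = c")
        case True
        then show ?thesis using orbit.base[of p a] by (simp add: pa)
      next
        case False
        then have "p y = q y" using px[OF \<open>y \<in> B\<close>] by simp
        then show ?thesis using orbit.step[OF step(2)] by simp
      qed
    qed
  qed
  with sub aself have Oa: "orbit p a = ?K" by auto
  have Oin: "orbit p x = ?K" if "x \<in> orbit q c" for x
  proof -
    have "x \<in> orbit p a" using that Oa by blast
    then have "orbit p x = orbit p a"
      by (rule orbit_bij_eq[OF bijp finite.insertI[OF assms(2)] insertI1])
    then show ?thesis by (simp only: Oa)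
  qed
  \<comment> \<open>A cycle other than that of c never meets the one element of B where
    \<open>p\<close> and \<open>q\<close> differ, the preimage of c under \<open>q\<close>.\<close>
  have Oout: "orbit p x = orbit q x" if x: "x \<in> B" "x \<notin> orbit q c" for x
  proof (rule orbit_cong[OF obq(2)[OF x(1)]])
    fix s assume s: "s \<in> orbit q x"
    have "s \<in> B" using s obq(1)[OF x(1)] by blast
    moreover have "q s \<noteq> c"
    proof
      assume "q s = c"
      then have "c \<in> orbit q x" using orbit.step[OF s] by simp
      then have "orbit q c = orbit q x" by (rule orbit_bij_eq[OF bij assms(2) x(1)])
      then show False using x obq(2)[OF x(1)] by simp
    qed
    ultimately show "p s = q s" using px by simp
  qed
  have neq: "orbit q x \<noteq> orbit q c \<longleftrightarrow> x \<notin> orbit q c" if "x \<in> B" for x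
    using obq(2)[OF that] orbit_bij_eq[OF bij assms(2,4), of x] by auto
  have split: "insert a B = {a} \<union> orbit q c \<union> (B - orbit q c)"
    using obq(1)[OF assms(4)] by blast
  have "orbit p ` ({a} \<union> orbit q c) = {?K}"
    using Oa Oin by (auto simp del: insert_iff)
  moreover have "orbit p ` (B - orbit q c) = orbit q ` (B - orbit q c)"
    using Oout by (intro image_cong) auto
  moreover have "orbit q ` (B - orbit q c) = orbit q ` B - {orbit q c}"
    using neq by (auto simp: image_iff)
  ultimately have img: "orbit p ` insert a B = insert ?K (orbit q ` B - {orbit q c})"
    by (simp only: split image_Un insert_is_Un[of ?K, symmetric])
  have mem: "orbit q c \<in># mset_set (orbit q ` B)" using assms by simp
  then show "card (orbit q c) \<in># cycle_type q B" by (auto simp: cycle_type_def)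
  have notin: "?K \<notin> orbit q ` B - {orbit q c}"
  proof
    assume "?K \<in> orbit q ` B - {orbit q c}"
    then obtain x where "x \<in> B" and "?K = orbit q x" by blast
    have "a \<in> orbit q x" unfolding \<open>?K = orbit q x\<close>[symmetric] by (rule insertI1)
    then show False using subsetD[OF obq(1)[OF \<open>x \<in> B\<close>]] assms(3) by blast
  qed
  have "a \<notin> orbit q c" using obq(1)[OF assms(4)] assms(3) by blast
  then have cardO: "card ?K = Suc (card (orbit q c))" using obq(3)[OF assms(4)] by simp
  have "cycle_type p (insert a B) =
      add_mset (card ?K) (image_mset card (mset_set (orbit q ` B - {orbit q c})))"
    unfolding cycle_type_def img using assms(2) notin by simp
  also have "mset_set (orbit q ` B - {orbit q c}) = mset_set (orbit q ` B) - {#orbit q c#}"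
    using assms by (simp add: mset_set_Diff)
  also have "image_mset card \<dots> = cycle_type q B - {#card (orbit q c)#}"
    unfolding cycle_type_def using mem by (subst image_mset_Diff) auto
  finally show "cycle_type (Transposition.transpose a c \<circ> q) (insert a B) =
      add_mset (Suc (card (orbit q c))) (cycle_type q B - {#card (orbit q c)#})"
    by (simp add: p_def[symmetric] cardO)
qed

section \<open>Counting permutations by cycle type; conjugacy\<close>

text \<open>Raising the multiplicity of k from m to m + 1 multiplies k^m m! by k (m + 1).\<close>

lemma z_partition_add_mset:
  "z_partition (add_mset k \<nu>) = z_partition \<nu> * (k * Suc (count \<nu> k))"
proof -
  define t where "t m i = i ^ count m i * fact (count m i)" for m :: "nat multiset" and i
  let ?S = "insert k (set_mset \<nu>)"
  have "z_partition (add_mset k \<nu>) = t (add_mset k \<nu>) k * (\<Prod>i\<in>?S - {k}. t (add_mset k \<nu>) i)"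
    by (simp add: z_partition_def t_def prod.remove[of ?S k])
  also have "(\<Prod>i\<in>?S - {k}. t (add_mset k \<nu>) i) = (\<Prod>i\<in>?S - {k}. t \<nu> i)"
    by (rule prod.cong) (auto simp: t_def)
  also have "t (add_mset k \<nu>) k = t \<nu> k * (k * Suc (count \<nu> k))"
    by (simp add: t_def algebra_simps)
  finally have "z_partition (add_mset k \<nu>) = (\<Prod>i\<in>?S. t \<nu> i) * (k * Suc (count \<nu> k))"
    by (simp add: prod.remove[of ?S k] mult_ac)
  \<comment> \<open>If k is not a part of \<nu>, its factor is k^0 0! = 1, so the larger index set
    does no harm.\<close>
  also have "(\<Prod>i\<in>?S. t \<nu> i) = (\<Prod>i\<in>set_mset \<nu>. t \<nu> i)"
    by (rule prod.mono_neutral_right) (auto simp: t_def not_in_iff)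
  finally show ?thesis by (simp add: z_partition_def t_def)
qed

lemma z_partition_pos: "0 \<notin># \<mu> \<Longrightarrow> 0 < z_partition \<mu>"
  unfolding z_partition_def by (intro prod_pos) (auto intro!: Nat.gr0I)

lemma sum_mult_count_eq_sum_mset:
  assumes "finite S" "set_mset \<mu> \<subseteq> S"
  shows "(\<Sum>k\<in>S. k * count \<mu> k) = sum_mset \<mu>"
proof -
  have "sum_mset \<mu> = (\<Sum>k\<in>S. k * count \<mu> k)"
    using assms(2)
  proof (induction \<mu>)
    case (add x \<mu>)
    have "(\<Sum>k\<in>S. k * count (add_mset x \<mu>) k) = (\<Sum>k\<in>S. k * count \<mu> k + (if k = x then x else 0))"
      by (intro sum.cong) auto
    also have "\<dots> = (\<Sum>k\<in>S. k * count \<mu> k) + x"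
      using add.prems assms(1) by (simp add: sum.distrib)
    finally show ?case using add by simp
  qed simp
  then show ?thesis ..
qed

text \<open>Groups points by the length of their cycle. In the count below, the cycle type after
  inserting a new element before c depends only on the length of the cycle of c, so the sum over c
  becomes a sum over lengths.\<close>

lemma sum_card_orbit:
  fixes g :: "nat \<Rightarrow> nat"
  assumes "bij_betw f X X" "finite X"
  shows "(\<Sum>x\<in>X. g (card (orbit f x))) = (\<Sum>l=1..card X. l * num_cycles f X l * g l)"
proof -
  have "(\<Sum>x\<in>X. g (card (orbit f x))) =
      (\<Sum>l=1..card X. \<Sum>x\<in>{x \<in> X. card (orbit f x) = l}. g (card (orbit f x)))"
    using card_orbit_bij_pos[OF assms] card_orbit_bij_le[OF assms] assms(2)
    by (intro sum.group[symmetric]) (auto simp: Suc_le_eq)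
  also have "\<dots> = (\<Sum>l=1..card X. l * num_cycles f X l * g l)"
    by (simp add: mult_num_cycles[OF assms])
  finally show ?thesis .
qed

lemma partitions_of_le:
  assumes "\<mu> \<in> partitions_of k" "i \<in># \<mu>"
  shows "1 \<le> i \<and> i \<le> k"
proof -
  obtain \<nu> where "\<mu> = add_mset i \<nu>" using multi_member_split[OF assms(2)] by blast
  then show ?thesis using assms(1) by (auto simp: partitions_of_def Suc_le_eq)
qed

lemma finite_partitions_of: "finite (partitions_of k)"
proof (rule finite_subset)
  show "partitions_of k \<subseteq> {\<mu>. set_mset \<mu> \<subseteq> {1..k} \<and> size \<mu> \<le> k}"
  proof safe
    fix \<mu> assume \<mu>: "\<mu> \<in> partitions_of k"
    show "i \<in> {1..k}" if "i \<in># \<mu>" for i using partitions_of_le[OF \<mu> that] by simp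
    have "size \<mu> = (\<Sum>i\<in>#\<mu>. 1)" by simp
    also have "\<dots> \<le> sum_mset (image_mset id \<mu>)"
      using partitions_of_le[OF \<mu>] by (intro sum_mset_mono) auto
    finally show "size \<mu> \<le> k" using \<mu> by (simp add: partitions_of_def)
  qed
  have "{\<mu>. set_mset \<mu> \<subseteq> {1..k} \<and> size \<mu> \<le> k} \<subseteq> mset ` {xs. set xs \<subseteq> {1..k} \<and> length xs \<le> k}"
  proof
    fix \<mu> :: "nat multiset" assume "\<mu> \<in> {\<mu>. set_mset \<mu> \<subseteq> {1..k} \<and> size \<mu> \<le> k}"
    moreover obtain xs where "mset xs = \<mu>" using ex_mset by blast
    ultimately show "\<mu> \<in> mset ` {xs. set xs \<subseteq> {1..k} \<and> length xs \<le> k}"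
      by (auto intro!: image_eqI[of _ _ xs])
  qed
  then show "finite {\<mu>. set_mset \<mu> \<subseteq> {1..k} \<and> size \<mu> \<le> k}"
    by (rule finite_subset) (intro finite_imageI finite_lists_length_le finite_atLeastAtMost)
qed

text \<open>Induction on the set: a new element either becomes a fixed point or is inserted into a cycle.\<close>

theorem card_permutes_cycle_type:
  assumes "finite A" "\<mu> \<in> partitions_of (card A)"
  shows "card {p. p permutes A \<and> cycle_type p A = \<mu>} * z_partition \<mu> = fact (card A)"
  using assms
proof (induction A arbitrary: \<mu> rule: finite_induct)
  case empty
  then have "\<mu> = {#}"
    using partitions_of_le[OF empty] by (cases \<mu>) fastforce+
  moreover have "{p. p permutes ({} :: 'a set) \<and> cycle_type p {} = {#}} = {id}"
    by (auto simp: cycle_type_def)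
  ultimately show ?case by (simp add: z_partition_def)
next
  case (insert a B)
  let ?Q = "{q. q permutes B}"
  let ?N = "\<lambda>\<nu>. card {q. q permutes B \<and> cycle_type q B = \<nu>}"
  have finQ: "finite ?Q" by (rule finite_permutations[OF insert(1)])
  have N: "?N \<nu> = (\<Sum>q\<in>?Q. if cycle_type q B = \<nu> then 1 else 0)" for \<nu>
    using finQ by (simp add: sum.If_cases Int_def)
  have cardA: "card (insert a B) = Suc (card B)" using insert by simp
  have \<mu>: "0 \<notin># \<mu>" "sum_mset \<mu> = Suc (card B)"
    using insert.prems by (auto simp: partitions_of_def cardA)
  have part: "\<mu> - {#k#} \<in> partitions_of (Suc (card B) - k)" if k: "k \<in># \<mu>" for k
  proof -
    obtain \<nu> where "\<mu> = add_mset k \<nu>" using multi_member_split[OF k] by blast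
    then show ?thesis using \<mu> by (simp add: partitions_of_def)
  qed
  \<comment> \<open>If \<mu> arises from \<nu> by adding a part 1, the induction hypothesis for
    \<nu> applies and \<open>z_partition\<close> grows by the factor \<open>count \<mu> 1\<close>.
    If \<mu> has no part 1, both sides vanish.\<close>
  have fixed: "(\<Sum>q\<in>?Q. if cycle_type q (insert a B) = \<mu> then 1 else 0) * z_partition \<mu>
      = 1 * count \<mu> 1 * fact (card B)"
  proof (cases "1 \<in># \<mu>")
    case True
    then obtain \<nu> where \<nu>: "\<mu> = add_mset 1 \<nu>" by (meson multi_member_split)
    have "(\<Sum>q\<in>?Q. if cycle_type q (insert a B) = \<mu> then 1 else 0) = ?N \<nu>"
      unfolding N using insert(1,2)
      by (intro sum.cong) (auto simp: cycle_type_insert_fixed \<nu>)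
    moreover have "?N \<nu> * z_partition \<nu> = fact (card B)"
      using part[OF True] by (intro insert.IH) (simp add: \<nu>)
    ultimately show ?thesis
      by (simp add: \<nu> z_partition_add_mset algebra_simps)
  next
    case False
    have "cycle_type q (insert a B) \<noteq> \<mu>" if "q permutes B" for q
      using cycle_type_insert_fixed[OF that insert(1,2)] False by auto
    then have "(\<Sum>q\<in>?Q. if cycle_type q (insert a B) = \<mu> then 1 else 0) = (0::nat)"
      by (intro sum.neutral) auto
    with False show ?thesis by (simp add: not_in_iff)
  qed
  \<comment> \<open>Removing the new element from a cycle of length \<open>Suc l\<close> leaves the
    type \<open>add_mset l \<rho>\<close>. A permutation of this type has
    \<open>l * Suc (count \<rho> l)\<close> points on cycles of length l, and this is exactly the
    ratio of \<open>z_partition\<close> at that type to \<open>z_partition \<rho>\<close>.\<close>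
  have inserted: "(\<Sum>q\<in>?Q. l * num_cycles q B l *
        (if add_mset (Suc l) (cycle_type q B - {#l#}) = \<mu> then 1 else 0)) * z_partition \<mu>
      = Suc l * count \<mu> (Suc l) * fact (card B)" (is "?L * _ = _") if l: "l \<in> {1..card B}" for l
  proof (cases "Suc l \<in># \<mu>")
    case True
    then obtain \<rho> where \<rho>: "\<mu> = add_mset (Suc l) \<rho>" by (meson multi_member_split)
    let ?\<nu> = "add_mset l \<rho>"
    have eq: "l * num_cycles q B l * (if add_mset (Suc l) (cycle_type q B - {#l#}) = \<mu> then 1 else 0)
        = (if cycle_type q B = ?\<nu> then 1 else 0) * (l * Suc (count \<rho> l))" for q
    proof (cases "l \<in># cycle_type q B")
      case True
      then have "cycle_type q B - {#l#} = \<rho> \<longleftrightarrow> cycle_type q B = ?\<nu>"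
        by (metis add_mset_remove_trivial insert_DiffM)
      then show ?thesis by (auto simp: \<rho> num_cycles_def)
    next
      case False
      then have "cycle_type q B \<noteq> ?\<nu>" by auto
      then show ?thesis using False by (auto simp: num_cycles_def not_in_iff)
    qed
    have L: "?L = ?N ?\<nu> * (l * Suc (count \<rho> l))"
      unfolding eq N sum_distrib_right ..
    have IH: "?N ?\<nu> * z_partition ?\<nu> = fact (card B)"
    proof (rule insert.IH)
      have "\<rho> \<in> partitions_of (card B - l)" using part[OF True] by (simp add: \<rho>)
      then show "?\<nu> \<in> partitions_of (card B)" using l by (auto simp: partitions_of_def)
    qed
    have "z_partition \<mu> = z_partition \<rho> * (Suc l * count \<mu> (Suc l))"
      by (simp add: \<rho> z_partition_add_mset)
    then have "?L * z_partition \<mu> = ?N ?\<nu> * z_partition ?\<nu> * (Suc l * count \<mu> (Suc l))"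
      unfolding L by (simp only: z_partition_add_mset mult_ac)
    then show ?thesis
      unfolding IH by (simp only: mult_ac)
  next
    case False
    have "add_mset (Suc l) (cycle_type q B - {#l#}) \<noteq> \<mu>" for q
      using False by auto
    with False show ?thesis by (simp add: not_in_iff)
  qed
  have transp: "(\<Sum>c\<in>B. if cycle_type (Transposition.transpose a c \<circ> q) (insert a B) = \<mu> then 1 else 0) =
      (\<Sum>l=1..card B. l * num_cycles q B l *
        (if add_mset (Suc l) (cycle_type q B - {#l#}) = \<mu> then 1 else 0))" if q: "q permutes B" for q
    using cycle_type_insert_transpose(2)[OF q insert(1,2)]
    by (subst sum_card_orbit[OF permutes_imp_bij[OF q] insert(1), symmetric]) simp
  have "card {p. p permutes insert a B \<and> cycle_type p (insert a B) = \<mu>} =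
      (\<Sum>p | p permutes insert a B. if cycle_type p (insert a B) = \<mu> then 1 else 0)"
    using finite_permutations[of "insert a B"] insert(1) by (simp add: sum.If_cases Int_def)
  \<comment> \<open>Each permutation p of the larger set is uniquely
    \<open>transpose a c \<circ> q\<close> with c = p a and \<open>q\<close> fixing a; the choice c
    = a makes a a fixed point.\<close>
  also have "\<dots> = (\<Sum>c\<in>insert a B. \<Sum>q\<in>?Q.
      if cycle_type (Transposition.transpose a c \<circ> q) (insert a B) = \<mu> then 1 else 0)"
    by (rule sum_over_permutations_insert[OF insert(1,2)])
  also have "\<dots> = (\<Sum>q\<in>?Q. if cycle_type q (insert a B) = \<mu> then 1 else 0) +
     (\<Sum>q\<in>?Q. \<Sum>c\<in>B. if cycle_type (Transposition.transpose a c \<circ> q) (insert a B) = \<mu> then 1 else 0)"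
    using insert(1,2) by (subst (2) sum.swap) simp
  also have "(\<Sum>q\<in>?Q. \<Sum>c\<in>B.
      if cycle_type (Transposition.transpose a c \<circ> q) (insert a B) = \<mu> then 1 else 0) =
    (\<Sum>q\<in>?Q. \<Sum>l=1..card B. l * num_cycles q B l *
        (if add_mset (Suc l) (cycle_type q B - {#l#}) = \<mu> then 1 else 0))"
    using transp by (intro sum.cong) auto
  also have "\<dots> = (\<Sum>l=1..card B. \<Sum>q\<in>?Q. l * num_cycles q B l *
        (if add_mset (Suc l) (cycle_type q B - {#l#}) = \<mu> then 1 else 0))"
    by (rule sum.swap)
  finally have "card {p. p permutes insert a B \<and> cycle_type p (insert a B) = \<mu>} * z_partition \<mu> =
      1 * count \<mu> 1 * fact (card B) + (\<Sum>l=1..card B. Suc l * count \<mu> (Suc l) * fact (card B))"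
    by (simp only: distrib_right fixed sum_distrib_right[where A = "{1..card B}"] inserted cong: sum.cong)
  also have "\<dots> = (1 * count \<mu> 1 + (\<Sum>l=1..card B. Suc l * count \<mu> (Suc l))) * fact (card B)"
    by (simp only: distrib_right sum_distrib_right)
  \<comment> \<open>The contributions of all possible lengths k of the cycle through a add up to the
    sum of the parts of \<mu>, which is the size of the new set and lifts the factorial by
    one.\<close>
  also have "(1 * count \<mu> 1 + (\<Sum>l=1..card B. Suc l * count \<mu> (Suc l))) =
      (\<Sum>k=1..Suc (card B). k * count \<mu> k)"
    using sum.atLeast_Suc_atMost[of 1 "Suc (card B)" "\<lambda>k. k * count \<mu> k"]
    by (simp add: sum.shift_bounds_cl_Suc_ivl del: sum.cl_ivl_Suc)
  also have "\<dots> = Suc (card B)"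
    using insert.prems partitions_of_le[OF insert.prems] \<mu>(2)
    by (subst sum_mult_count_eq_sum_mset) (auto simp: cardA)
  finally show ?case by (simp add: cardA)
qed

section \<open>Conjugacy of permutations with equal cycle types\<close>

lemma orbit_complement:
  assumes f: "bij_betw f A A" "finite A" and x: "x \<in> A"
  shows bij_betw_Diff_orbit: "bij_betw f (A - orbit f x) (A - orbit f x)"
    and cycle_type_Diff_orbit: "cycle_type f (A - orbit f x) = cycle_type f A - {#card (orbit f x)#}"
proof -
  note ob = orbit_bij_betw[OF f]
  let ?C = "orbit f x"
  have eq: "orbit f z = ?C \<longleftrightarrow> z \<in> ?C" if "z \<in> A" for z
    using ob(2)[OF that] orbit_bij_eq[OF f x, of z] by auto
  have "orbit f ` (A - ?C) = orbit f ` A - {?C}"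
    using eq by (auto simp: image_iff)
  then have "mset_set (orbit f ` (A - ?C)) = mset_set (orbit f ` A) - {#?C#}"
    using f(2) x by (simp add: mset_set_Diff)
  then show "cycle_type f (A - ?C) = cycle_type f A - {#card ?C#}"
    unfolding cycle_type_def using f(2) x by (simp add: image_mset_Diff)
  have "f ` ?C \<subseteq> ?C" by (auto intro: orbit.step)
  moreover have inj: "inj_on f ?C"
    using f(1) ob(1)[OF x] by (auto simp: bij_betw_def intro: inj_on_subset)
  ultimately have "f ` ?C = ?C"
    using ob(3)[OF x] by (intro card_subset_eq) (auto simp: card_image)
  with inj have "bij_betw f ?C ?C" by (simp add: bij_betw_def)
  with f(1) show "bij_betw f (A - ?C) (A - ?C)"
    by (rule bij_betw_DiffI) (use ob(1)[OF x] in auto)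
qed

lemma bij_betw_funpow_orbit:
  assumes f: "bij_betw f A A" "finite A" and x: "x \<in> A"
  shows funpow_card_orbit: "(f ^^ card (orbit f x)) x = x"
    and "bij_betw (\<lambda>k. (f ^^ k) x) {..<card (orbit f x)} (orbit f x)"
proof -
  show per: "(f ^^ card (orbit f x)) x = x"
    using funpow_fixed_iff_card_orbit_dvd[OF f x, of "card (orbit f x)"] by simp
  have "(\<lambda>k. (f ^^ k) x) ` {..<card (orbit f x)} = orbit f x"
    using orbit_altdef_bounded[OF per card_orbit_bij_pos[OF f x]] by auto
  then show "bij_betw (\<lambda>k. (f ^^ k) x) {..<card (orbit f x)} (orbit f x)"
    by (simp add: bij_betw_def eq_card_imp_inj_on)
qed

text \<open>The k-th iterate of x is sent to the k-th iterate of y. Equal lengths are needed where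
  the cycles close up, at exponent \<open>?n\<close>, since both iterations must return to their
  starting points simultaneously.\<close>

lemma conj_of_card_orbit_eq:
  assumes f: "bij_betw f A A" "finite A" "x \<in> A" and g: "bij_betw g B B" "finite B" "y \<in> B"
    and eq: "card (orbit f x) = card (orbit g y)"
  obtains h where "bij_betw h (orbit f x) (orbit g y)" "\<And>z. z \<in> orbit f x \<Longrightarrow> h (f z) = g (h z)"
proof -
  let ?n = "card (orbit f x)"
  let ?i = "\<lambda>k. (f ^^ k) x" and ?j = "\<lambda>k. (g ^^ k) y"
  have i: "bij_betw ?i {..<?n} (orbit f x)" by (rule bij_betw_funpow_orbit[OF f])
  have j: "bij_betw ?j {..<?n} (orbit g y)" unfolding eq by (rule bij_betw_funpow_orbit[OF g])
  define h where "h = ?j \<circ> inv_into {..<?n} ?i"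
  have h: "h (?i k) = ?j k" if "k < ?n" for k
    using that bij_betw_inv_into_left[OF i, of k] by (simp add: h_def)
  have n0: "0 < ?n" by (rule card_orbit_bij_pos[OF f])
  have per: "?i ?n = x" "?j ?n = y"
    using funpow_card_orbit[OF f] funpow_card_orbit[OF g] by (simp_all only: eq)
  show thesis
  proof
    show "bij_betw h (orbit f x) (orbit g y)"
      unfolding h_def by (rule bij_betw_trans[OF bij_betw_inv_into[OF i] j])
    fix z assume "z \<in> orbit f x"
    then obtain k where k: "k < ?n" "z = ?i k"
      using i by (force simp: bij_betw_def)
    have "h (?i (Suc k)) = ?j (Suc k)"
    proof (cases "Suc k = ?n")
      case True
      then show ?thesis using h[OF n0] per by (simp del: funpow.simps)
    next
      case False
      then show ?thesis using h[of "Suc k"] k(1) by simp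
    qed
    then show "h (f z) = g (h z)" using h[OF k(1)] by (simp add: k(2))
  qed
qed

text \<open>Induction by stripping cycles: a cycle of \<open>f\<close> is matched with a cycle of
  \<open>g\<close> of the same length, the complements are invariant with equal cycle types, and the
  two conjugating maps are put together.\<close>

lemma conj_of_cycle_type_eq:
  assumes "bij_betw f A A" "finite A" "bij_betw g B B" "finite B" "cycle_type f A = cycle_type g B"
  shows "\<exists>h. bij_betw h A B \<and> (\<forall>x\<in>A. h (f x) = g (h x))"
  using assms
proof (induction "card A" arbitrary: A B rule: less_induct)
  case less
  show ?case
  proof (cases "A = {}")
    case True
    have "card B = card A"
      by (simp only: sum_mset_cycle_type[OF less(2,3), symmetric]
          sum_mset_cycle_type[OF less(4,5), symmetric] less(6))
    then have "B = {}" using True less(5) by simp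
    with True show ?thesis by (simp add: bij_betw_def)
  next
    case False
    then obtain x where x: "x \<in> A" by blast
    let ?C = "orbit f x"
    have "card ?C \<in># cycle_type g B"
      unfolding less(6)[symmetric] using x less(3) by (auto simp: cycle_type_def)
    then obtain y where y: "y \<in> B" "card ?C = card (orbit g y)"
      using less(5) by (auto simp: cycle_type_def)
    let ?D = "orbit g y"
    note C = orbit_bij_betw[OF less(2,3) x] and D = orbit_bij_betw[OF less(4,5) y(1)]
    obtain h1 where h1: "bij_betw h1 ?C ?D" "\<And>z. z \<in> ?C \<Longrightarrow> h1 (f z) = g (h1 z)"
      using conj_of_card_orbit_eq[OF less(2,3) x less(4,5) y] by blast
    have "card (A - ?C) < card A"
      using C x less(3) by (intro psubset_card_mono) auto
    then obtain h2 where h2: "bij_betw h2 (A - ?C) (B - ?D)" "\<And>z. z \<in> A - ?C \<Longrightarrow> h2 (f z) = g (h2 z)"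
      using less(1)[of "A - ?C" "B - ?D"] less(3,5,6) y(2)
        orbit_complement[OF less(2,3) x] orbit_complement[OF less(4,5) y(1)]
      by auto
    define h where "h z = (if z \<in> ?C then h1 z else h2 z)" for z
    have "bij_betw h (?C \<union> (A - ?C)) (?D \<union> (B - ?D))"
      unfolding h_def using h1(1) h2(1) by (rule bij_betw_disjoint_Un) auto
    then have "bij_betw h A B"
      using C(1) D(1) by (simp add: Un_absorb1)
    moreover have "h (f z) = g (h z)" if "z \<in> A" for z
    proof (cases "z \<in> ?C")
      case True
      then show ?thesis using h1(2) by (simp add: h_def orbit.step)
    next
      case False
      have "f z \<notin> ?C"
        using bij_betw_apply[OF bij_betw_Diff_orbit[OF less(2,3) x], of z] that False by simp
      then show ?thesis using h2(2) that False by (simp add: h_def)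
    qed
    ultimately show ?thesis by blast
  qed
qed

section \<open>Cycle monomials and substitution\<close>

lemma zconst_simps:
  shows zconst_0: "zconst 0 = 0"
    and zconst_1: "zconst 1 = 1"
    and zconst_mult: "zconst (x * y) = zconst x * zconst y"
    and zconst_add: "zconst (x + y) = zconst x + zconst y"
    and zconst_of_nat: "zconst (of_nat n) = of_nat n"
  by (simp_all add: zconst_def mult_single single_add)

lemma zvar_power: "zvar j ^ k = Poly_Mapping.single (Poly_Mapping.single j k) 1"
proof (induction k)
  case (Suc k)
  have "zvar j ^ Suc k = Poly_Mapping.single (Poly_Mapping.single j 1 + Poly_Mapping.single j k) 1"
    by (simp only: power_Suc Suc) (simp add: zvar_def mult_single)
  also have "Poly_Mapping.single j 1 + Poly_Mapping.single j k = Poly_Mapping.single j (Suc k)"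
    by (simp flip: single_add)
  finally show ?case .
qed simp

lemma prod_zvar_power:
  "(\<Prod>j\<in>S. zvar j ^ m j) = Poly_Mapping.single (\<Sum>j\<in>S. Poly_Mapping.single j (m j)) 1"
  by (induction S rule: infinite_finite_induct) (simp_all add: zvar_power mult_single)

text \<open>Cancellation can make the keys of a sum fewer than the union of the keys. Over a common
  larger index set the extra terms have coefficient 0, and additivity of \<open>zsubst\<close>
  becomes visible.\<close>

lemma zsubst_superset:
  assumes "finite S" "Poly_Mapping.keys p \<subseteq> S"
  shows "zsubst p g = (\<Sum>e\<in>S. zconst (Poly_Mapping.lookup p e) *
    (\<Prod>j\<in>Poly_Mapping.keys e. g j ^ Poly_Mapping.lookup e j))"
  unfolding zsubst_def using assms
  by (intro sum.mono_neutral_left) (auto simp: in_keys_iff zconst_0)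

lemma zsubst_0: "zsubst 0 g = 0"
  by (simp add: zsubst_def)

lemma zsubst_add: "zsubst (p + q) g = zsubst p g + zsubst q g"
proof -
  let ?S = "Poly_Mapping.keys p \<union> Poly_Mapping.keys q"
  have "Poly_Mapping.keys (p + q) \<subseteq> ?S" by (rule keys_add)
  then show ?thesis
    by (simp add: zsubst_superset[of ?S] lookup_add zconst_add distrib_right sum.distrib)
qed

lemma zsubst_sum: "zsubst (\<Sum>x\<in>S. p x) g = (\<Sum>x\<in>S. zsubst (p x) g)"
  by (induction S rule: infinite_finite_induct) (simp_all add: zsubst_0 zsubst_add)

lemma zsubst_monomial:
  assumes "finite S"
  shows "zsubst (zconst c * (\<Prod>j\<in>S. zvar j ^ m j)) g = zconst c * (\<Prod>j\<in>S. g j ^ m j)"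
proof -
  let ?e = "\<Sum>j\<in>S. Poly_Mapping.single j (m j)"
  have lookup: "Poly_Mapping.lookup ?e i = (if i \<in> S then m i else 0)" for i
    using assms by (simp add: lookup_sum lookup_single when_def)
  have "zsubst (zconst c * (\<Prod>j\<in>S. zvar j ^ m j)) g = zsubst (Poly_Mapping.single ?e c) g"
    by (simp add: prod_zvar_power zconst_def mult_single)
  also have "\<dots> = zconst c * (\<Prod>j\<in>Poly_Mapping.keys ?e. g j ^ Poly_Mapping.lookup ?e j)"
    by (subst zsubst_superset[of "{?e}"]) (auto split: if_splits)
  \<comment> \<open>Indices of S with exponent 0 are not keys, but their factor
    \<open>g j ^ 0\<close> is 1.\<close>
  also have "(\<Prod>j\<in>Poly_Mapping.keys ?e. g j ^ Poly_Mapping.lookup ?e j) = (\<Prod>j\<in>S. g j ^ m j)"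
    using assms by (intro prod.mono_neutral_cong_left) (auto simp: in_keys_iff lookup split: if_splits)
  finally show ?thesis .
qed

lemma zsubst_cycle_index:
  "zsubst (cycle_index G \<phi> X) g = zconst (1 / of_nat (card G)) *
    (\<Sum>w\<in>G. \<Prod>i=1..card X. g i ^ num_cycles (\<phi> w) X i)"
  unfolding cycle_index_def sum_distrib_left zsubst_sum
  by (simp add: zsubst_monomial)

section \<open>Cycles of a product of two maps\<close>

lemma funpow_map_prod:
  fixes f :: "'a \<Rightarrow> 'a" and g :: "'b \<Rightarrow> 'b"
  shows "(map_prod f g ^^ k) (x, y) = ((f ^^ k) x, (g ^^ k) y)"
  by (induction k) auto

text \<open>An iterate fixes (x, y) iff it fixes both coordinates. Hence the cycle length and the
  lcm divide the same numbers, so each divides the other.\<close>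

lemma card_orbit_map_prod:
  assumes f: "bij_betw f X X" "finite X" "x \<in> X" and g: "bij_betw g Y Y" "finite Y" "y \<in> Y"
  shows "card (orbit (map_prod f g) (x, y)) = lcm (card (orbit f x)) (card (orbit g y))"
proof -
  have "card (orbit (map_prod f g) (x, y)) dvd k \<longleftrightarrow>
      lcm (card (orbit f x)) (card (orbit g y)) dvd k" for k
    using funpow_fixed_iff_card_orbit_dvd[OF bij_betw_map_prod[OF f(1) g(1)], of "(x, y)" k]
      funpow_fixed_iff_card_orbit_dvd[OF f, of k] funpow_fixed_iff_card_orbit_dvd[OF g, of k]
      f(2,3) g(2,3)
    by (simp add: funpow_map_prod)
  then show ?thesis by (meson dvd_antisym dvd_refl)
qed

text \<open>Points on i-cycles of \<open>f\<close> paired with points on j-cycles of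
  \<open>g\<close> lie on cycles of length lcm(i, j); dividing the number of such points by L gives
  the number of cycles. The quotient is split so that one factor is the exponent in
  \<open>f_perm\<close> and the other a cycle count of \<open>g\<close>.\<close>

lemma num_cycles_map_prod:
  assumes f: "bij_betw f X X" "finite X" and g: "bij_betw g Y Y" "finite Y" and "0 < L"
  shows "num_cycles (map_prod f g) (X \<times> Y) L =
    (\<Sum>(i, j) | (i, j) \<in> {1..card X} \<times> {1..card Y} \<and> lcm i j = L.
      (i * j * num_cycles f X i) div lcm i j * num_cycles g Y j)"
proof -
  let ?R = "{(i, j). (i, j) \<in> {1..card X} \<times> {1..card Y} \<and> lcm i j = L}"
  let ?a = "\<lambda>x. card (orbit f x)" and ?b = "\<lambda>y. card (orbit g y)"
  let ?X = "\<lambda>i. {x \<in> X. ?a x = i}" and ?Y = "\<lambda>j. {y \<in> Y. ?b y = j}"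
  have finR: "finite ?R" by (rule finite_subset[of _ "{1..card X} \<times> {1..card Y}"]) auto
  have "L * num_cycles (map_prod f g) (X \<times> Y) L =
      card {p \<in> X \<times> Y. card (orbit (map_prod f g) p) = L}"
    using f g by (intro mult_num_cycles bij_betw_map_prod) auto
  also have "{p \<in> X \<times> Y. card (orbit (map_prod f g) p) = L} = (\<Union>(i, j)\<in>?R. ?X i \<times> ?Y j)"
    using card_orbit_map_prod[OF f _ g] card_orbit_bij_pos[OF f] card_orbit_bij_pos[OF g]
      card_orbit_bij_le[OF f] card_orbit_bij_le[OF g]
    by (auto simp: Suc_le_eq)
  also have "card \<dots> = (\<Sum>(i, j)\<in>?R. card (?X i \<times> ?Y j))"
    using finR f(2) g(2) by (subst card_UN_disjoint) (auto simp: case_prod_beta)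
  also have "\<dots> = (\<Sum>(i, j)\<in>?R. L * ((i * j * num_cycles f X i) div lcm i j * num_cycles g Y j))"
  proof (intro sum.cong refl, clarify)
    fix i j assume L: "L = lcm i j"
    \<comment> \<open>This makes the natural number division exact, so multiplying back by the lcm
      loses nothing.\<close>
    have "lcm i j dvd i * j * num_cycles f X i"
      by (simp add: lcm_least)
    then have "lcm i j * ((i * j * num_cycles f X i) div lcm i j * num_cycles g Y j) =
        i * j * num_cycles f X i * num_cycles g Y j"
      by (metis dvd_mult_div_cancel mult.assoc)
    then show "card (?X i \<times> ?Y j) =
        lcm i j * ((i * j * num_cycles f X i) div lcm i j * num_cycles g Y j)"
      by (simp add: card_cartesian_product mult_num_cycles[OF f, symmetric]
          mult_num_cycles[OF g, symmetric] mult_ac)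
  qed
  also have "\<dots> = L * (\<Sum>(i, j)\<in>?R. (i * j * num_cycles f X i) div lcm i j * num_cycles g Y j)"
    by (simp add: sum_distrib_left case_prod_beta)
  finally show ?thesis using \<open>0 < L\<close> by simp
qed

text \<open>The right side is the cycle monomial of \<open>g\<close> with z_j replaced by the
  polynomial attached to \<open>f\<close>. Sorting its factors by the value L of lcm(i, j) collects
  the exponents into the cycle counts of the product.\<close>

lemma cycle_monomial_map_prod:
  assumes f: "bij_betw f X X" "finite X" and g: "bij_betw g Y Y" "finite Y"
  shows "(\<Prod>L=1..card (X \<times> Y). zvar L ^ num_cycles (map_prod f g) (X \<times> Y) L) =
    (\<Prod>j=1..card Y. (\<Prod>i=1..card X. zvar (lcm i j) ^ ((i * j * num_cycles f X i) div lcm i j))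
       ^ num_cycles g Y j)"
proof -
  let ?R = "{1..card X} \<times> {1..card Y}"
  let ?E = "\<lambda>(i, j). (i * j * num_cycles f X i) div lcm i j * num_cycles g Y j"
  let ?l = "\<lambda>(i, j). lcm i j :: nat"
  have "(\<Prod>j=1..card Y. (\<Prod>i=1..card X. zvar (lcm i j) ^ ((i * j * num_cycles f X i) div lcm i j))
       ^ num_cycles g Y j) =
    (\<Prod>j=1..card Y. \<Prod>i=1..card X. zvar (?l (i, j)) ^ ?E (i, j))"
    by (simp add: prod_power_distrib power_mult)
  also have "\<dots> = (\<Prod>p\<in>?R. zvar (?l p) ^ ?E p)"
    by (subst prod.swap) (simp add: prod.cartesian_product case_prod_beta)
  also have "\<dots> = (\<Prod>L=1..card (X \<times> Y). \<Prod>p\<in>{p \<in> ?R. ?l p = L}. zvar (?l p) ^ ?E p)"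
  proof (rule prod.group[symmetric])
    show "?l ` ?R \<subseteq> {1..card (X \<times> Y)}"
    proof clarify
      fix i j assume "i \<in> {1..card X}" "j \<in> {1..card Y}"
      then have "0 < lcm i j" "lcm i j \<le> i * j" "i * j \<le> card X * card Y"
        by (auto simp: lcm_pos_nat intro: mult_le_mono dvd_imp_le)
      then show "lcm i j \<in> {1..card (X \<times> Y)}" by (simp add: card_cartesian_product)
    qed
  qed auto
  also have "\<dots> = (\<Prod>L=1..card (X \<times> Y). zvar L ^ num_cycles (map_prod f g) (X \<times> Y) L)"
  proof (rule prod.cong[OF refl])
    fix L assume "L \<in> {1..card (X \<times> Y)}"
    then have "0 < L" by simp
    have "(\<Prod>p\<in>{p \<in> ?R. ?l p = L}. zvar (?l p) ^ ?E p) = (\<Prod>p\<in>{p \<in> ?R. ?l p = L}. zvar L ^ ?E p)"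
      by (rule prod.cong) auto
    also have "\<dots> = zvar L ^ (\<Sum>p\<in>{p \<in> ?R. ?l p = L}. ?E p)"
      by (rule power_sum[symmetric])
    also have "(\<Sum>p\<in>{p \<in> ?R. ?l p = L}. ?E p) = num_cycles (map_prod f g) (X \<times> Y) L"
      unfolding num_cycles_map_prod[OF f g \<open>0 < L\<close>] by (rule sum.cong) auto
    finally show "(\<Prod>p\<in>{p \<in> ?R. ?l p = L}. zvar (?l p) ^ ?E p) =
      zvar L ^ num_cycles (map_prod f g) (X \<times> Y) L" .
  qed
  finally show ?thesis ..
qed

section \<open>Decomposing signed permutations and cube vertices\<close>

lemma finite_cube_vertices: "finite (cube_vertices m)"
proof (rule finite_subset)
  show "cube_vertices m \<subseteq>
      {x. \<forall>i. (i \<in> {1..m} \<longrightarrow> x i \<in> {0, 1}) \<and> (i \<notin> {1..m} \<longrightarrow> x i = 0)}"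
    by (auto simp: cube_vertices_def space_R_def)
  show "finite {x. \<forall>i. (i \<in> {1..m} \<longrightarrow> x i \<in> {0, 1 :: real}) \<and> (i \<notin> {1..m} \<longrightarrow> x i = 0)}"
    by (rule finite_set_of_finite_funs) simp_all
qed

lemma finite_signed_perms: "finite (signed_perms m)"
  by (rule finite_subset[of _ "{p. p permutes {1..m}} \<times> Pow {1..m}"])
    (auto simp: signed_perms_def finite_permutations)

lemma bij_betw_act_space_R:
  assumes "w \<in> signed_perms m"
  shows "bij_betw (act m w) (space_R m) (space_R m)"
proof -
  obtain p N where w: "w = (p, N)" and p: "p permutes {1..m}"
    using assms by (auto simp: signed_perms_def)
  have pin: "p i \<in> {1..m} \<longleftrightarrow> i \<in> {1..m}" for i by (rule permutes_in_image[OF p])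
  \<comment> \<open>The inverse action, found by solving for the coordinate j = p i: the sign sits
    at the position i = \<open>inv p j\<close> of the image.\<close>
  define v where
    "v y = (\<lambda>j. if j \<in> {1..m} then (if inv p j \<in> N then 1 - y (inv p j) else y (inv p j)) else 0)"
    for y :: "nat \<Rightarrow> real"
  have inv: "inv p (p i) = i" "p (inv p i) = i" for i using permutes_inverses[OF p] by auto
  have invin: "inv p i \<in> {1..m} \<longleftrightarrow> i \<in> {1..m}" for i
    by (rule permutes_in_image[OF permutes_inv[OF p]])
  show ?thesis
  proof (rule bij_betw_byWitness[where f' = v])
    show "\<forall>x\<in>space_R m. v (act m w x) = x"
      using invin by (auto simp: v_def act_def w inv fun_eq_iff space_R_def)
    show "\<forall>y\<in>space_R m. act m w (v y) = y"
      using pin by (auto simp: v_def act_def w inv fun_eq_iff space_R_def)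
    show "act m w ` space_R m \<subseteq> space_R m" "v ` space_R m \<subseteq> space_R m"
      by (auto simp: act_def v_def space_R_def)
  qed
qed

lemma act_in_cube_vertices:
  assumes "w \<in> signed_perms m" "x \<in> cube_vertices m"
  shows "act m w x \<in> cube_vertices m"
proof -
  have p: "fst w permutes {1..m}" using assms(1) by (auto simp: signed_perms_def)
  have "x j \<in> {0, 1}" if "j \<in> {1..m}" for j
    using assms(2) that by (simp add: cube_vertices_def)
  then have "x (fst w i) = 0 \<or> x (fst w i) = 1" if "i \<in> {1..m}" for i
    using that permutes_in_image[OF p, of i] by blast
  then show ?thesis by (fastforce simp: cube_vertices_def space_R_def act_def)
qed

lemma bij_betw_act_subset:
  assumes "w \<in> signed_perms m" "X \<subseteq> cube_vertices m" "act m w ` X \<subseteq> X"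
  shows "bij_betw (act m w) X X"
proof -
  have "X \<subseteq> space_R m" using assms(2) by (auto simp: cube_vertices_def)
  then have "inj_on (act m w) X"
    using bij_betw_act_space_R[OF assms(1)] by (auto simp: bij_betw_def intro: inj_on_subset)
  moreover have "finite X" using assms(2) finite_cube_vertices by (rule finite_subset)
  ultimately show ?thesis using assms(3) by (simp add: bij_betw_def endo_inj_surj)
qed

lemma bij_betw_act_cube_vertices:
  "w \<in> signed_perms m \<Longrightarrow> bij_betw (act m w) (cube_vertices m) (cube_vertices m)"
  by (rule bij_betw_act_subset) (auto intro: act_in_cube_vertices)

text \<open>The test points have real coordinates and in general are not vertices of the cube. They
  are available because a stabilizing element preserves all of H, not merely its vertices; inclusion
  of one solution set in the other is enough.\<close>

lemma proportional_of_hyperplane_subset: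
  fixes A C :: "nat \<Rightarrow> real"
  assumes "1 \<le> n" "A 1 \<noteq> 0"
    and sub: "\<And>x. x \<in> space_R n \<Longrightarrow> (\<Sum>i=1..n. A i * x i) = b \<Longrightarrow> (\<Sum>i=1..n. C i * x i) = d"
  obtains c where "\<And>i. i \<in> {1..n} \<Longrightarrow> C i = c * A i" "d = c * b"
proof -
  define c where "c = C 1 / A 1"
  have delta: "(\<Sum>i=1..n. B i * (if i = k then u else 0)) = B k * u" if "k \<in> {1..n}"
    for B :: "nat \<Rightarrow> real" and k u
    using that by (simp add: if_distrib[of "(*) _"] cong: if_cong)
  have one: "1 \<in> {1..n}" using assms(1) by simp
  have "(\<Sum>i=1..n. C i * (if i = 1 then b / A 1 else 0)) = d"
  proof (rule sub)
    show "(\<lambda>i. if i = 1 then b / A 1 else 0) \<in> space_R n" using one by (auto simp: space_R_def)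
    show "(\<Sum>i=1..n. A i * (if i = 1 then b / A 1 else 0)) = b"
      unfolding delta[OF one] using assms(2) by simp
  qed
  then have d: "d = c * b" unfolding delta[OF one] by (simp add: c_def)
  have "C k = c * A k" if k: "k \<in> {1..n}" for k
  proof (cases "k = 1")
    case True
    then show ?thesis using assms(2) by (simp add: c_def)
  next
    case False
    let ?x = "\<lambda>i. (if i = 1 then (b - A k) / A 1 else 0) + (if i = k then 1 else 0)"
    have sum: "(\<Sum>i=1..n. B i * ?x i) = B 1 * ((b - A k) / A 1) + B k" for B :: "nat \<Rightarrow> real"
      by (simp only: distrib_left sum.distrib delta[OF one] delta[OF k] mult_1_right)
    have "(\<Sum>i=1..n. C i * ?x i) = d"
    proof (rule sub)
      show "?x \<in> space_R n" using assms(1) k by (auto simp: space_R_def)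
      show "(\<Sum>i=1..n. A i * ?x i) = b" unfolding sum using assms(2) by simp
    qed
    then show ?thesis unfolding sum d using assms(2) by (simp add: c_def field_simps)
  qed
  with d that show thesis by blast
qed

section \<open>Splitting points and signed permutations after coordinate t\<close>

definition join :: "nat \<Rightarrow> (nat \<Rightarrow> real) \<Rightarrow> (nat \<Rightarrow> real) \<Rightarrow> nat \<Rightarrow> real" where
  "join t x y = (\<lambda>i. if i \<le> t then x i else y (i - t))"

text \<open>The embedding of B_t \<times> B_{n-t} into B_n. As in \<open>join\<close>, index 0 falls
  into the first branch: there a permutation of {1..t} fixes it, and a point supported on {1..t} has
  value 0.\<close>

definition join_perm :: "nat \<Rightarrow> signed_perm \<Rightarrow> signed_perm \<Rightarrow> signed_perm" where
  "join_perm t v w =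
     ((\<lambda>i. if i \<le> t then fst v i else t + fst w (i - t)), snd v \<union> (+) t ` snd w)"

lemma permutes_join:
  fixes p q :: "nat \<Rightarrow> nat"
  assumes "p permutes {1..t}" "q permutes {1..n - t}" "t \<le> n"
  shows "(\<lambda>i. if i \<le> t then p i else t + q (i - t)) permutes {1..n}"
proof (rule bij_imp_permutes)
  have split: "{1..n} = {1..t} \<union> {t + 1..n}" using assms(3) by auto
  have shift: "bij_betw ((+) t) {1..n - t} {t + 1..n}"
    using assms(3) by (intro bij_betwI[where g = "\<lambda>i. i - t"]) auto
  have "bij_betw (\<lambda>i. i - t) {t + 1..n} {1..n - t}"
    using assms(3) by (intro bij_betwI[where g = "(+) t"]) auto
  from bij_betw_trans[OF bij_betw_trans[OF this permutes_imp_bij[OF assms(2)]] shift]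
  have "bij_betw (\<lambda>i. t + q (i - t)) {t + 1..n} {t + 1..n}" by (simp add: comp_def)
  with permutes_imp_bij[OF assms(1)]
  have "bij_betw (\<lambda>i. if i \<in> {1..t} then p i else t + q (i - t))
      ({1..t} \<union> {t + 1..n}) ({1..t} \<union> {t + 1..n})"
    by (rule bij_betw_disjoint_Un) auto
  then show "bij_betw (\<lambda>i. if i \<le> t then p i else t + q (i - t)) {1..n} {1..n}"
    unfolding split by (subst bij_betw_cong) auto
  show "(if i \<le> t then p i else t + q (i - t)) = i" if "i \<notin> {1..n}" for i
  proof (cases "i = 0")
    case True
    then show ?thesis using permutes_not_in[OF assms(1), of i] by simp
  next
    case False
    then have "n < i" using that by auto
    then have "i - t \<notin> {1..n - t}" "t < i" using assms(3) by auto
    then show ?thesis using permutes_not_in[OF assms(2)] by simp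
  qed
qed

lemma join_perm_in_signed_perms:
  assumes "v \<in> signed_perms t" "w \<in> signed_perms (n - t)" "t \<le> n"
  shows "join_perm t v w \<in> signed_perms n"
proof -
  have "(\<lambda>i. if i \<le> t then fst v i else t + fst w (i - t)) permutes {1..n}"
    using assms by (intro permutes_join) (auto simp: signed_perms_def)
  moreover have "snd v \<union> (+) t ` snd w \<subseteq> {1..n}"
    using assms by (fastforce simp: signed_perms_def)
  ultimately show ?thesis by (simp add: signed_perms_def join_perm_def)
qed

lemma act_join_perm:
  assumes "v \<in> signed_perms t" "w \<in> signed_perms (n - t)" "t \<le> n"
  shows "act n (join_perm t v w) (join t x y) = join t (act t v x) (act (n - t) w y)"
proof
  fix i
  have v: "fst v permutes {1..t}" "snd v \<subseteq> {1..t}" and w: "fst w permutes {1..n - t}" "snd w \<subseteq> {1..n - t}"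
    using assms by (auto simp: signed_perms_def)
  consider "i \<in> {1..t}" | "i \<in> {t + 1..n}" | "i = 0 \<or> n < i" by fastforce
  then show "act n (join_perm t v w) (join t x y) i = join t (act t v x) (act (n - t) w y) i"
  proof cases
    case 1
    then have "fst v i \<in> {1..t}" by (simp only: permutes_in_image[OF v(1)])
    moreover have "i \<notin> (+) t ` snd w" using 1 w(2) by auto
    moreover have "i \<in> {1..n}" "i \<le> t" using 1 assms(3) by auto
    ultimately show ?thesis
      using 1 by (simp add: act_def join_def join_perm_def)
  next
    case 2
    then have "i - t \<in> {1..n - t}" by auto
    then have "fst w (i - t) \<in> {1..n - t}" by (simp only: permutes_in_image[OF w(1)])
    moreover have "i \<in> (+) t ` snd w \<longleftrightarrow> i - t \<in> snd w" "i \<notin> snd v"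
      using 2 v(2) by (auto intro!: image_eqI[of _ _ "i - t"])
    moreover have "i \<in> {1..n}" "\<not> i \<le> t" using 2 by auto
    ultimately show ?thesis
      using \<open>i - t \<in> {1..n - t}\<close> by (simp add: act_def join_def join_perm_def)
  next
    case 3
    then show ?thesis
    proof
      assume "i = 0"
      then show ?thesis by (simp add: act_def join_def)
    next
      assume "n < i"
      then have "i - t \<notin> {1..n - t}" "\<not> i \<le> t" using assms(3) by auto
      then show ?thesis using \<open>n < i\<close> by (simp add: act_def join_def)
    qed
  qed
qed

lemma inj_on_join_perm:
  "inj_on (\<lambda>(v, w). join_perm t v w) (signed_perms t \<times> signed_perms m)"
proof (rule inj_onI)
  fix u u'
  assume u: "u \<in> signed_perms t \<times> signed_perms m" "u' \<in> signed_perms t \<times> signed_perms m"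
    and eq_u: "(case u of (v, w) \<Rightarrow> join_perm t v w) = (case u' of (v, w) \<Rightarrow> join_perm t v w)"
  obtain p N q M p' N' q' M' where u_eq: "u = ((p, N), (q, M))" "u' = ((p', N'), (q', M'))"
    by (metis surj_pair)
  have eq: "join_perm t (p, N) (q, M) = join_perm t (p', N') (q', M')"
    and in_perms: "(p, N) \<in> signed_perms t" "(q, M) \<in> signed_perms m"
      "(p', N') \<in> signed_perms t" "(q', M') \<in> signed_perms m"
    using u eq_u by (auto simp: u_eq)
  have eq1: "(if i \<le> t then p i else t + q (i - t)) = (if i \<le> t then p' i else t + q' (i - t))" for i
    using fun_cong[OF arg_cong[OF eq, of fst], of i]
    by (simp add: join_perm_def cong: if_cong)
  have eq2: "N \<union> (+) t ` M = N' \<union> (+) t ` M'"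
    using eq by (simp add: join_perm_def)
  have perms: "p permutes {1..t}" "q permutes {1..m}" "p' permutes {1..t}" "q' permutes {1..m}"
    and sets: "N \<subseteq> {1..t}" "M \<subseteq> {1..m}" "N' \<subseteq> {1..t}" "M' \<subseteq> {1..m}"
    using in_perms by (auto simp: signed_perms_def)
  have "p i = p' i" for i
    using eq1[of i] permutes_not_in[OF perms(1), of i] permutes_not_in[OF perms(3), of i]
    by (cases "i \<le> t") auto
  moreover have "q i = q' i" for i
    using eq1[of "t + i"] permutes_not_in[OF perms(2), of i] permutes_not_in[OF perms(4), of i]
    by (cases "i = 0") auto
  moreover have "N = N'"
  proof -
    have "N = (N \<union> (+) t ` M) \<inter> {1..t}" using sets by auto
    also have "\<dots> = N'" unfolding eq2 using sets by auto
    finally show ?thesis .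
  qed
  moreover have "M = M'"
  proof -
    have "(+) t ` M = (N \<union> (+) t ` M) - {1..t}" using sets by auto
    also have "\<dots> = (+) t ` M'" unfolding eq2 using sets by auto
    finally show ?thesis by (simp add: inj_image_eq_iff)
  qed
  ultimately show "u = u'" by (simp add: u_eq fun_eq_iff)
qed

lemma hyperplane_of_cong:
  assumes "\<And>i. i \<in> {1..t} \<Longrightarrow> x i = y i" "x \<in> space_R m" "y \<in> space_R m'"
  shows "x \<in> hyperplane_of m t a b \<longleftrightarrow> y \<in> hyperplane_of m' t a b"
  using assms by (simp add: hyperplane_of_def)

text \<open>The equation involves only the first t coordinates, so the remaining ones run freely
  over a cube of dimension n - t.\<close>

lemma bij_betw_join:
  assumes "t \<le> n"
  shows "bij_betw (\<lambda>(x, y). join t x y)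
    ((hyperplane_of t t a b \<inter> cube_vertices t) \<times> cube_vertices (n - t))
    (hyperplane_of n t a b \<inter> cube_vertices n)"
\<comment> \<open>In the second component index 0 must be reset to 0, since \<open>z (t + 0)\<close>
  is a coordinate of the first part.\<close>
proof (rule bij_betw_byWitness[where f' =
    "\<lambda>z. (\<lambda>i. if i \<le> t then z i else 0, \<lambda>i. if i = 0 then 0 else z (t + i))"])
  let ?V = "hyperplane_of t t a b \<inter> cube_vertices t"
  show "\<forall>p\<in>?V \<times> cube_vertices (n - t).
      (\<lambda>z. (\<lambda>i. if i \<le> t then z i else 0, \<lambda>i. if i = 0 then 0 else z (t + i)))
        ((\<lambda>(x, y). join t x y) p) = p"
    by (auto simp: join_def fun_eq_iff cube_vertices_def space_R_def)
  show "\<forall>z\<in>hyperplane_of n t a b \<inter> cube_vertices n. (\<lambda>(x, y). join t x y)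
      (\<lambda>i. if i \<le> t then z i else 0, \<lambda>i. if i = 0 then 0 else z (t + i)) = z"
    by (auto simp: join_def fun_eq_iff cube_vertices_def space_R_def)
  show "(\<lambda>(x, y). join t x y) ` (?V \<times> cube_vertices (n - t)) \<subseteq> hyperplane_of n t a b \<inter> cube_vertices n"
  proof clarify
    fix x y assume x: "x \<in> hyperplane_of t t a b" "x \<in> cube_vertices t" and y: "y \<in> cube_vertices (n - t)"
    have "join t x y i \<in> {0, 1}" if "i \<in> {1..n}" for i
    proof (cases "i \<le> t")
      case True
      then show ?thesis using that x(2) by (auto simp: join_def cube_vertices_def)
    next
      case False
      then have "i - t \<in> {1..n - t}" using that by auto
      then show ?thesis using False y by (auto simp: join_def cube_vertices_def)
    qed
    moreover have "join t x y \<in> space_R n"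
    proof -
      have "i - t \<notin> {1..n - t}" if "\<not> i \<le> n" for i using that assms by auto
      then show ?thesis using x(2) y assms by (auto simp: join_def cube_vertices_def space_R_def)
    qed
    ultimately have "join t x y \<in> cube_vertices n" by (simp add: cube_vertices_def)
    moreover have "join t x y \<in> hyperplane_of n t a b"
      using x \<open>join t x y \<in> space_R n\<close>
      by (subst hyperplane_of_cong[of t _ x _ t]) (auto simp: join_def cube_vertices_def)
    ultimately show "join t x y \<in> hyperplane_of n t a b \<inter> cube_vertices n" by blast
  qed
  show "(\<lambda>z. (\<lambda>i. if i \<le> t then z i else 0, \<lambda>i. if i = 0 then 0 else z (t + i))) `
      (hyperplane_of n t a b \<inter> cube_vertices n) \<subseteq> ?V \<times> cube_vertices (n - t)"
  proof (rule image_subsetI)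
    fix z assume "z \<in> hyperplane_of n t a b \<inter> cube_vertices n"
    then have z: "z \<in> hyperplane_of n t a b" "z \<in> cube_vertices n" by auto
    let ?x = "\<lambda>i. if i \<le> t then z i else 0" and ?y = "\<lambda>i. if i = 0 then 0 else z (t + i)"
    have "z 0 = 0" using z(2) by (simp add: cube_vertices_def space_R_def)
    then have "?x \<in> cube_vertices t" "?y \<in> cube_vertices (n - t)"
      using z(2) assms by (auto simp: cube_vertices_def space_R_def)
    moreover have "?x \<in> hyperplane_of t t a b"
      using z \<open>?x \<in> cube_vertices t\<close>
      by (subst hyperplane_of_cong[of t _ z _ n]) (auto simp: cube_vertices_def)
    ultimately show "(?x, ?y) \<in> ?V \<times> cube_vertices (n - t)" by blast
  qed
qed

section \<open>The stabilizer of a hyperplane\<close>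

text \<open>The group \<open>P(H)\<close> of the paper.\<close>

definition block_group :: "nat \<Rightarrow> (nat \<Rightarrow> nat) \<Rightarrow> nat \<Rightarrow> signed_perm set" where
  "block_group t a b = S_plus t a \<union> (if hyperplane_delta t a b = 1 then S_minus t a else {})"

lemma S_plus_subset: "S_plus t a \<subseteq> signed_perms t"
  and S_minus_subset: "S_minus t a \<subseteq> signed_perms t"
  by (auto simp: S_plus_def S_minus_def signed_perms_def)

lemma block_group_subset: "block_group t a b \<subseteq> signed_perms t"
  using S_plus_subset S_minus_subset by (auto simp: block_group_def)

lemma finite_block: "finite (block t a i)"
  by (simp add: block_def)

text \<open>By monotonicity \<open>a t\<close> is the largest coefficient, so the blocks with index
  in {1..a t} cover {1..t}. Indices that are not coefficients have empty blocks; these admit only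
  the partition \<open>{#}\<close> with \<open>z_partition\<close> 1 and contribute trivial
  factors.\<close>

lemma block_value:
  assumes "1 \<le> t" "\<And>j. j \<in> {1..t} \<Longrightarrow> 0 < a j" "mono_on {1..t} a" "j \<in> {1..t}"
  shows "a j \<in> {1..a t} \<and> j \<in> block t a (a j)"
  using assms(2)[OF assms(4)] mono_onD[OF assms(3,4), of t] assms(1,4)
  by (auto simp: block_def)

text \<open>Membership in terms of preserved coefficients, which is what the invariance of the
  equation yields directly.\<close>

lemma S_plus_iff:
  assumes "1 \<le> t" "\<And>j. j \<in> {1..t} \<Longrightarrow> 0 < a j" "mono_on {1..t} a"
  shows "(p, N) \<in> S_plus t a \<longleftrightarrow> N = {} \<and> p permutes {1..t} \<and> (\<forall>j\<in>{1..t}. a (p j) = a j)"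
proof -
  have in_block: "a j \<in> {1..a t} \<and> j \<in> block t a (a j)" if "j \<in> {1..t}" for j
    by (rule block_value) (use assms that in auto)
  have "(\<forall>i\<in>{1..a t}. p ` block t a i = block t a i) \<longleftrightarrow> (\<forall>j\<in>{1..t}. a (p j) = a j)"
    if p: "p permutes {1..t}"
  proof
    assume L: "\<forall>i\<in>{1..a t}. p ` block t a i = block t a i"
    show "\<forall>j\<in>{1..t}. a (p j) = a j"
    proof
      fix j assume "j \<in> {1..t}"
      then have "p j \<in> block t a (a j)" using L in_block[of j] by blast
      then show "a (p j) = a j" by (simp add: block_def)
    qed
  next
    assume R: "\<forall>j\<in>{1..t}. a (p j) = a j"
    show "\<forall>i\<in>{1..a t}. p ` block t a i = block t a i"
    proof
      fix i
      have "p ` block t a i \<subseteq> block t a i"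
        using R permutes_in_image[OF p] by (auto simp: block_def)
      then show "p ` block t a i = block t a i"
        using permutes_inj_on[OF p] by (intro endo_inj_surj) (auto simp: block_def)
    qed
  qed
  then show ?thesis by (auto simp: S_plus_def)
qed

lemma hyperplane_delta_eq_1_iff: "hyperplane_delta t a b = 1 \<longleftrightarrow> (\<Sum>j=1..t. a j) = 2 * b"
  by (simp add: hyperplane_delta_def)

text \<open>Permutations inside blocks leave the linear form unchanged up to renaming. Negating all
  coordinates turns a value s into the coefficient sum minus s, which is 2b - s when \<delta> = 1,
  and 2b - s = b iff s = b.\<close>

lemma block_group_sum:
  assumes "1 \<le> t" "\<And>j. j \<in> {1..t} \<Longrightarrow> 0 < a j" "mono_on {1..t} a" and v: "v \<in> block_group t a b"
  shows "(\<Sum>j=1..t. real (a j) * act t v x j) = real b \<longleftrightarrow> (\<Sum>j=1..t. real (a j) * x j) = real b"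
proof -
  obtain p N where vpN: "v = (p, N)" by (cases v)
  have p: "(p, {}) \<in> S_plus t a" and N: "N = {} \<or> N = {1..t} \<and> hyperplane_delta t a b = 1"
    using v by (auto simp: vpN block_group_def S_minus_def S_plus_def split: if_splits)
  have perm: "p permutes {1..t}" and ap: "\<And>j. j \<in> {1..t} \<Longrightarrow> a (p j) = a j"
    using p S_plus_iff[of t a p "{}"] assms(1-3) by blast+
  have "(\<Sum>j=1..t. real (a j) * x (p j)) = (\<Sum>j=1..t. real (a (p j)) * x (p j))"
    using ap by (intro sum.cong) auto
  also have "\<dots> = (\<Sum>j=1..t. real (a j) * x j)"
    using sum.permute[OF perm, of "\<lambda>j. real (a j) * x j"] by (simp add: comp_def)
  finally have eq: "(\<Sum>j=1..t. real (a j) * x (p j)) = (\<Sum>j=1..t. real (a j) * x j)" .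
  from N show ?thesis
  proof
    assume "N = {}"
    then have "(\<Sum>j=1..t. real (a j) * act t v x j) = (\<Sum>j=1..t. real (a j) * x (p j))"
      by (intro sum.cong) (auto simp: act_def vpN)
    then show ?thesis by (simp only: eq)
  next
    assume N: "N = {1..t} \<and> hyperplane_delta t a b = 1"
    then have "(\<Sum>j=1..t. a j) = 2 * b" by (simp only: hyperplane_delta_eq_1_iff)
    then have "real (\<Sum>j=1..t. a j) = real (2 * b)" by (rule arg_cong)
    then have suma: "(\<Sum>j=1..t. real (a j)) = 2 * real b" by simp
    have "(\<Sum>j=1..t. real (a j) * act t v x j) = (\<Sum>j=1..t. real (a j) - real (a j) * x (p j))"
      using N by (intro sum.cong) (auto simp: act_def vpN algebra_simps)
    also have "\<dots> = 2 * real b - (\<Sum>j=1..t. real (a j) * x j)"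
      by (simp only: sum_subtractf eq suma)
    finally show ?thesis by auto
  qed
qed

lemma stabilizer_of_block_group:
  assumes "1 \<le> t" "t \<le> n" "\<And>j. j \<in> {1..t} \<Longrightarrow> 0 < a j" "mono_on {1..t} a"
    and v: "v \<in> block_group t a b" and w: "w \<in> signed_perms (n - t)"
  shows "join_perm t v w \<in> hyperplane_stabilizer n (hyperplane_of n t a b)"
proof -
  let ?u = "join_perm t v w" and ?H = "hyperplane_of n t a b"
  have vt: "v \<in> signed_perms t" using v block_group_subset by blast
  have u: "?u \<in> signed_perms n" by (rule join_perm_in_signed_perms[OF vt w assms(2)])
  have "act n ?u x j = act t v x j" if "j \<in> {1..t}" for j x
    using that assms(2) w by (auto simp: act_def join_perm_def signed_perms_def)
  then have "(\<Sum>j=1..t. real (a j) * act n ?u x j) = (\<Sum>j=1..t. real (a j) * act t v x j)" for x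
    by (intro sum.cong) auto
  then have iff: "(\<Sum>j=1..t. real (a j) * act n ?u x j) = real b \<longleftrightarrow> (\<Sum>j=1..t. real (a j) * x j) = real b" for x
    using block_group_sum[OF assms(1,3,4) v] by simp
  have "act n ?u ` space_R n = space_R n"
    using bij_betw_act_space_R[OF u] by (simp add: bij_betw_def)
  then have "act n ?u ` ?H = ?H"
    unfolding hyperplane_of_def using iff by (auto simp: set_eq_iff image_iff) metis+
  with u show ?thesis by (simp add: hyperplane_stabilizer_def)
qed

lemma block_group_of_stabilizer:
  assumes t: "1 \<le> t" "t \<le> n" and pos: "\<And>j. j \<in> {1..t} \<Longrightarrow> 0 < a j" and "mono_on {1..t} a"
    and stab: "u \<in> hyperplane_stabilizer n (hyperplane_of n t a b)"
  obtains v w where "v \<in> block_group t a b" "w \<in> signed_perms (n - t)" "u = join_perm t v w"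
proof -
  obtain p N where upN: "u = (p, N)" and p: "p permutes {1..n}" and N: "N \<subseteq> {1..n}"
    using stab by (auto simp: hyperplane_stabilizer_def signed_perms_def)
  \<comment> \<open>\<open>A\<close> extends the coefficients by 0 to all of {1..n}. Substituting
    \<open>act n u x\<close> into the equation gives the coefficient vector \<open>C\<close>, and
    the constants 1 in 1 - x at negated positions add up to \<open>s\<close>.\<close>
  define A where "A i = (if i \<le> t then real (a i) else 0)" for i
  define e where "e i = (if i \<in> N then - 1 else 1 :: real)" for i
  define C where "C i = e (inv p i) * A (inv p i)" for i
  define s where "s = (\<Sum>i=1..n. if i \<in> N then A i else 0)"
  have inv: "inv p (p i) = i" for i using permutes_inverses(2)[OF p] .
  have pin: "p i \<in> {1..n} \<longleftrightarrow> i \<in> {1..n}" for i by (rule permutes_in_image[OF p])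
  have A0: "0 \<le> A i" for i by (simp add: A_def)
  have Apos: "0 < A i \<longleftrightarrow> i \<in> {1..t}" if "i \<in> {1..n}" for i
    using pos[of i] that by (auto simp: A_def)
  have sumA: "(\<Sum>i=1..n. A i * x i) = (\<Sum>j=1..t. real (a j) * x j)" for x :: "nat \<Rightarrow> real"
    using t(2) by (intro sum.mono_neutral_cong_right) (auto simp: A_def)
  have "(\<Sum>i=1..n. C i * x i) = real b - s"
    if x: "x \<in> space_R n" "(\<Sum>i=1..n. A i * x i) = real b" for x
  proof -
    have "x \<in> hyperplane_of n t a b" using x by (simp only: hyperplane_of_def sumA mem_Collect_eq)
    then have "act n u x \<in> hyperplane_of n t a b"
      using stab by (auto simp: hyperplane_stabilizer_def)
    then have "real b = (\<Sum>i=1..n. A i * act n u x i)" by (simp only: hyperplane_of_def sumA mem_Collect_eq)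
    also have "\<dots> = (\<Sum>i=1..n. e i * A i * x (p i) + (if i \<in> N then A i else 0))"
      by (intro sum.cong) (auto simp: act_def upN e_def algebra_simps)
    also have "\<dots> = (\<Sum>i=1..n. e i * A i * x (p i)) + s" by (simp add: sum.distrib s_def)
    also have "(\<Sum>i=1..n. e i * A i * x (p i)) = (\<Sum>i=1..n. C i * x i)"
      by (subst (2) sum.permute[OF p]) (simp add: C_def inv)
    finally show ?thesis by simp
  qed
  moreover have "1 \<le> n" "A 1 \<noteq> 0" using t pos[of 1] by (auto simp: A_def)
  ultimately obtain c where c: "\<And>i. i \<in> {1..n} \<Longrightarrow> C i = c * A i" "real b - s = c * real b"
    using proportional_of_hyperplane_subset[of n A "real b" C "real b - s"] by blast
  have eA: "e i * A i = c * A (p i)" if "i \<in> {1..n}" for i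
  proof -
    have "C (p i) = c * A (p i)" by (rule c(1)) (use that pin in blast)
    then show ?thesis by (simp only: C_def inv)
  qed
  have absA: "A i = \<bar>c\<bar> * A (p i)" if "i \<in> {1..n}" for i
  proof -
    have "A i = \<bar>e i * A i\<bar>" using A0[of i] by (simp add: e_def abs_mult)
    also have "\<dots> = \<bar>c\<bar> * A (p i)" unfolding eA[OF that] using A0[of "p i"] by (simp add: abs_mult)
    finally show ?thesis .
  qed
  \<comment> \<open>Permuting the indices does not change the total of \<open>A\<close>, and this
    total is positive, so the absolute value of c must be 1.\<close>
  have "(\<Sum>i=1..n. A i) = (\<Sum>i=1..n. \<bar>c\<bar> * A (p i))" using absA by (intro sum.cong) auto
  also have "\<dots> = \<bar>c\<bar> * (\<Sum>i=1..n. A i)"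
    using sum.permute[OF p, of A] by (simp add: sum_distrib_left comp_def)
  finally have "(\<Sum>i=1..n. A i) = \<bar>c\<bar> * (\<Sum>i=1..n. A i)" .
  moreover have "0 < (\<Sum>i=1..n. A i)"
    using A0 Apos[of 1] t by (intro sum_pos2[of _ 1]) auto
  ultimately have c1: "\<bar>c\<bar> = 1" by simp
  have Ap: "A (p i) = A i" if "i \<in> {1..n}" for i using absA[OF that] c1 by simp
  \<comment> \<open>Positions 1 to t are those where \<open>A\<close> is positive, and
    \<open>A\<close> is invariant under \<open>p\<close>; this splits \<open>p\<close> into a
    permutation of {1..t} and one of the rest.\<close>
  have pt: "p i \<in> {1..t} \<longleftrightarrow> i \<in> {1..t}" if "i \<in> {1..n}" for i
  proof -
    have "p i \<in> {1..n}" using that pin by blast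
    from Apos[OF this] Apos[OF that] show ?thesis unfolding Ap[OF that] by blast
  qed
  \<comment> \<open>Here \<open>A i\<close> is nonzero and can be cancelled, so all signs on {1..t}
    agree with c; beyond t the signs remain free.\<close>
  have e: "e i = c" if "i \<in> {1..t}" for i
  proof -
    have "i \<in> {1..n}" using that t(2) by auto
    then show ?thesis using eA[of i] Ap[of i] Apos[of i] that by auto
  qed
  define p1 where "p1 = perm_restrict p {1..t}"
  define p2 where "p2 i = (if i \<in> {1..n - t} then p (t + i) - t else i)" for i
  have inj: "inj p" by (rule permutes_inj[OF p])
  have p1: "p1 permutes {1..t}"
  proof -
    have "p ` {1..t} \<subseteq> {1..t}" using pt t(2) by auto
    then have "p ` {1..t} = {1..t}"
      by (rule endo_inj_surj[OF finite_atLeastAtMost _ permutes_inj_on[OF p]])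
    then have "bij_betw p {1..t} {1..t}"
      using permutes_inj_on[OF p] by (rule bij_betw_imageI[rotated])
    then show ?thesis unfolding p1_def by (rule perm_restrict_permutes)
  qed
  have ptn: "p (t + i) \<in> {t + 1..n}" if "i \<in> {1..n - t}" for i
  proof -
    have "t + i \<in> {1..n}" "t + i \<notin> {1..t}" using that by auto
    then have "p (t + i) \<in> {1..n}" "p (t + i) \<notin> {1..t}" using pin pt by blast+
    then show ?thesis by auto
  qed
  have p2: "p2 permutes {1..n - t}"
  proof (rule bij_imp_permutes)
    have "p2 ` {1..n - t} \<subseteq> {1..n - t}"
      using ptn by (force simp: p2_def)
    moreover have "inj_on p2 {1..n - t}"
    proof (rule inj_onI)
      fix i j assume ij: "i \<in> {1..n - t}" "j \<in> {1..n - t}" "p2 i = p2 j"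
      then have "p (t + i) - t = p (t + j) - t" by (simp add: p2_def)
      \<comment> \<open>These bounds keep the truncated subtraction injective.\<close>
      moreover have "t \<le> p (t + i)" "t \<le> p (t + j)" using ptn[OF ij(1)] ptn[OF ij(2)] by auto
      ultimately have "p (t + i) = p (t + j)" by (simp only: eq_diff_iff)
      then show "i = j" using inj by (simp add: inj_eq)
    qed
    ultimately show "bij_betw p2 {1..n - t} {1..n - t}" by (simp add: bij_betw_def endo_inj_surj)
  qed (auto simp: p2_def)
  define N2 where "N2 = {i \<in> {1..n - t}. t + i \<in> N}"
  have "(+) t ` N2 = N - {1..t}"
  proof
    show "N - {1..t} \<subseteq> (+) t ` N2"
    proof
      fix i assume i: "i \<in> N - {1..t}"
      then have "i - t \<in> {1..n - t}" "t + (i - t) = i" using N by auto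
      then show "i \<in> (+) t ` N2" using i by (intro image_eqI[of _ _ "i - t"]) (auto simp: N2_def)
    qed
  qed (auto simp: N2_def)
  moreover have "(\<lambda>i. if i \<le> t then p1 i else t + p2 (i - t)) = p"
  proof
    fix i
    consider "i = 0" | "i \<in> {1..t}" | "i \<in> {t + 1..n}" | "n < i" by fastforce
    then show "(if i \<le> t then p1 i else t + p2 (i - t)) = p i"
    proof cases
      case 1
      then show ?thesis using permutes_not_in[OF p, of 0] by (simp add: p1_def perm_restrict_def)
    next
      case 2
      then show ?thesis by (simp add: p1_def perm_restrict_def)
    next
      case 3
      then have "i - t \<in> {1..n - t}" "t + (i - t) = i" by auto
      then show ?thesis using 3 ptn[of "i - t"] by (simp add: p2_def)
    next
      case 4
      then have "i - t \<notin> {1..n - t}" "t < i" using t(2) by auto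
      then show ?thesis using 4 permutes_not_in[OF p, of i] by (simp add: p2_def)
    qed
  qed
  ultimately have u: "u = join_perm t (p1, N \<inter> {1..t}) (p2, N2)"
    unfolding upN join_perm_def fst_conv snd_conv by auto
  have ap1: "a (p1 j) = a j" if "j \<in> {1..t}" for j
  proof -
    have "j \<in> {1..n}" using that t(2) by auto
    then have "A (p j) = A j" "p j \<in> {1..t}" using Ap pt that by blast+
    then show ?thesis using that by (simp add: A_def p1_def perm_restrict_def)
  qed
  have plus: "(p1, {}) \<in> S_plus t a"
    using p1 ap1 S_plus_iff[of t a p1 "{}"] t(1) pos assms(4) by blast
  have "(p1, N \<inter> {1..t}) \<in> block_group t a b"
  proof (cases "c = 1")
    case True
    then have "N \<inter> {1..t} = {}" using e by (force simp: e_def)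
    then show ?thesis using plus by (simp add: block_group_def)
  next
    case False
    \<comment> \<open>All of {1..t} is negated, so \<open>s\<close> is the full coefficient sum, and
      b - s = -b is precisely the condition for \<delta> = 1.\<close>
    then have cm: "c = - 1" using c1 by linarith
    then have sub: "{1..t} \<subseteq> N" using e by (force simp: e_def split: if_splits)
    have "s = (\<Sum>i=1..n. A i * 1)"
      unfolding s_def using sub by (intro sum.cong) (auto simp: A_def)
    also have "\<dots> = real (\<Sum>j=1..t. a j)" unfolding sumA by simp
    finally have "real (\<Sum>j=1..t. a j) = real (2 * b)" using c(2) cm by simp
    then have "hyperplane_delta t a b = 1" by (simp only: hyperplane_delta_eq_1_iff of_nat_eq_iff)
    moreover have "N \<inter> {1..t} = {1..t}" using sub by blast
    ultimately show ?thesis using plus by (auto simp: block_group_def S_minus_def)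
  qed
  moreover have "(p2, N2) \<in> signed_perms (n - t)"
    using p2 by (auto simp: signed_perms_def N2_def)
  ultimately show thesis using u that by blast
qed

lemma bij_betw_join_perm:
  assumes "1 \<le> t" "t \<le> n" "\<And>j. j \<in> {1..t} \<Longrightarrow> 0 < a j" "mono_on {1..t} a"
  shows "bij_betw (\<lambda>(v, w). join_perm t v w) (block_group t a b \<times> signed_perms (n - t))
    (hyperplane_stabilizer n (hyperplane_of n t a b))"
proof -
  have "inj_on (\<lambda>(v, w). join_perm t v w) (block_group t a b \<times> signed_perms (n - t))"
    using block_group_subset by (intro inj_on_subset[OF inj_on_join_perm]) blast
  moreover have "(\<lambda>(v, w). join_perm t v w) ` (block_group t a b \<times> signed_perms (n - t)) =
      hyperplane_stabilizer n (hyperplane_of n t a b)" (is "?L = ?R")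
  proof
    show "?L \<subseteq> ?R" using stabilizer_of_block_group[OF assms] by auto
    show "?R \<subseteq> ?L"
    proof
      fix u assume "u \<in> ?R"
      then obtain v w where "v \<in> block_group t a b" "w \<in> signed_perms (n - t)" "u = join_perm t v w"
        using block_group_of_stabilizer[OF assms] by metis
      then show "u \<in> ?L" by (intro image_eqI[of _ _ "(v, w)"]) auto
    qed
  qed
  ultimately show ?thesis by (simp add: bij_betw_def)
qed

lemma bij_betw_act_block_group:
  assumes "1 \<le> t" "\<And>j. j \<in> {1..t} \<Longrightarrow> 0 < a j" "mono_on {1..t} a" "v \<in> block_group t a b"
  shows "bij_betw (act t v) (hyperplane_of t t a b \<inter> cube_vertices t)
    (hyperplane_of t t a b \<inter> cube_vertices t)"
proof (rule bij_betw_act_subset)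
  show v: "v \<in> signed_perms t" using assms(4) block_group_subset by blast
  show "act t v ` (hyperplane_of t t a b \<inter> cube_vertices t) \<subseteq> hyperplane_of t t a b \<inter> cube_vertices t"
  proof (rule image_subsetI)
    fix x assume x: "x \<in> hyperplane_of t t a b \<inter> cube_vertices t"
    then have "act t v x \<in> cube_vertices t" using act_in_cube_vertices[OF v] by blast
    with x block_group_sum[OF assms, of x]
    show "act t v x \<in> hyperplane_of t t a b \<inter> cube_vertices t"
      by (simp add: hyperplane_of_def cube_vertices_def)
  qed
qed simp

section \<open>Cycle index of the stabilizer as an average over P(H)\<close>

lemma cycle_monomial_join_perm:
  assumes "1 \<le> t" "t \<le> n" "\<And>j. j \<in> {1..t} \<Longrightarrow> 0 < a j" "mono_on {1..t} a"
    and v: "v \<in> block_group t a b" and w: "w \<in> signed_perms (n - t)"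
  defines "X \<equiv> hyperplane_of t t a b \<inter> cube_vertices t"
    and "Y \<equiv> cube_vertices (n - t)" and "Z \<equiv> hyperplane_of n t a b \<inter> cube_vertices n"
  shows "(\<Prod>i=1..card Z. zvar i ^ num_cycles (act n (join_perm t v w)) Z i) =
    (\<Prod>j=1..card Y. f_perm t X v j ^ num_cycles (act (n - t) w) Y j)"
proof -
  have f: "bij_betw (act t v) X X"
    unfolding X_def by (rule bij_betw_act_block_group) (use assms in auto)
  have g: "bij_betw (act (n - t) w) Y Y"
    unfolding Y_def by (rule bij_betw_act_cube_vertices[OF w])
  have fin: "finite X" "finite Y"
    by (simp_all add: X_def Y_def finite_cube_vertices)
  have h: "bij_betw (\<lambda>(x, y). join t x y) (X \<times> Y) Z"
    unfolding X_def Y_def Z_def by (rule bij_betw_join[OF assms(2)])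
  have vt: "v \<in> signed_perms t" using v block_group_subset by blast
  have "cycle_type (act n (join_perm t v w)) Z = cycle_type (map_prod (act t v) (act (n - t) w)) (X \<times> Y)"
    by (rule cycle_type_conj[OF bij_betw_map_prod[OF f g] _ h])
      (use fin act_join_perm[OF vt w assms(2)] in auto)
  moreover have "card (X \<times> Y) = card Z" by (rule bij_betw_same_card[OF h])
  ultimately show ?thesis
    using cycle_monomial_map_prod[OF f fin(1) g fin(2)]
    by (simp add: num_cycles_def f_perm_def)
qed

text \<open>For fixed v the average over w in B_{n-t} is the cycle index of the smaller cube
  evaluated at the polynomials of v. For n = t that cube is a single vertex with the trivial group,
  whose cycle index is z_1.\<close>

lemma cycle_index_stabilizer:
  fixes b :: nat
  assumes "1 \<le> t" "t \<le> n" "\<And>j. j \<in> {1..t} \<Longrightarrow> 0 < a j" "mono_on {1..t} a"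
  defines "X \<equiv> hyperplane_of t t a b \<inter> cube_vertices t"
  shows "cycle_index (hyperplane_stabilizer n (hyperplane_of n t a b)) (act n)
      (hyperplane_of n t a b \<inter> cube_vertices n) =
    zconst (1 / of_nat (card (block_group t a b))) *
      (\<Sum>v\<in>block_group t a b. zsubst (cube_cycle_index (n - t)) (f_perm t X v))"
proof -
  let ?Z = "hyperplane_of n t a b \<inter> cube_vertices n" and ?Y = "cube_vertices (n - t)"
  let ?S = "hyperplane_stabilizer n (hyperplane_of n t a b)"
  let ?B = "block_group t a b" and ?W = "signed_perms (n - t)"
  have bij: "bij_betw (\<lambda>(v, w). join_perm t v w) (?B \<times> ?W) ?S"
    by (rule bij_betw_join_perm) (use assms in auto)
  have "card ?S = card ?B * card ?W"
    using bij_betw_same_card[OF bij] by (simp add: card_cartesian_product)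
  then have "zconst (1 / of_nat (card ?S)) = zconst (1 / of_nat (card ?B)) * zconst (1 / of_nat (card ?W))"
    by (simp flip: zconst_mult)
  moreover have "(\<Sum>u\<in>?S. \<Prod>i=1..card ?Z. zvar i ^ num_cycles (act n u) ?Z i) =
      (\<Sum>v\<in>?B. \<Sum>w\<in>?W. \<Prod>j=1..card ?Y. f_perm t X v j ^ num_cycles (act (n - t) w) ?Y j)"
  proof -
    have "(\<Sum>u\<in>?S. \<Prod>i=1..card ?Z. zvar i ^ num_cycles (act n u) ?Z i) =
        (\<Sum>(v, w)\<in>?B \<times> ?W. \<Prod>i=1..card ?Z. zvar i ^ num_cycles (act n (join_perm t v w)) ?Z i)"
      using sum.reindex_bij_betw[OF bij,
          of "\<lambda>u. \<Prod>i=1..card ?Z. zvar i ^ num_cycles (act n u) ?Z i"]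
      by (simp add: case_prod_beta)
    also have "\<dots> = (\<Sum>(v, w)\<in>?B \<times> ?W. \<Prod>j=1..card ?Y. f_perm t X v j ^ num_cycles (act (n - t) w) ?Y j)"
      unfolding X_def
      by (intro sum.cong refl) (use cycle_monomial_join_perm[OF assms(1-4)] in auto)
    finally show ?thesis by (simp add: sum.cartesian_product)
  qed
  ultimately show ?thesis
    by (simp add: cycle_index_def[of ?S] cube_cycle_index_def zsubst_cycle_index mult.assoc
        flip: sum_distrib_left)
qed

section \<open>S_\<alpha> as a product of symmetric groups, sorted by cycle types\<close>

definition glue :: "nat \<Rightarrow> (nat \<Rightarrow> nat) \<Rightarrow> (nat \<Rightarrow> nat \<Rightarrow> nat) \<Rightarrow> nat \<Rightarrow> nat" where
  "glue t a q = (\<lambda>j. if j \<in> {1..t} then q (a j) j else j)"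

text \<open>The pieces are only required to be bijective on their blocks, because the conjugating
  maps obtained from equal cycle types are unspecified elsewhere.\<close>

lemma glue_in_S_plus:
  assumes "\<And>i. i \<in> {1..a t} \<Longrightarrow> bij_betw (q i) (block t a i) (block t a i)"
    and "1 \<le> t" "\<And>j. j \<in> {1..t} \<Longrightarrow> 0 < a j" "mono_on {1..t} a"
  shows "(glue t a q, {}) \<in> S_plus t a"
    and "\<And>j. j \<in> {1..t} \<Longrightarrow> glue t a q j = q (a j) j"
proof -
  have val: "a j \<in> {1..a t} \<and> j \<in> block t a (a j)" if "j \<in> {1..t}" for j
    by (rule block_value) (use assms(2-4) that in auto)
  show eq: "\<And>j. j \<in> {1..t} \<Longrightarrow> glue t a q j = q (a j) j" by (simp add: glue_def)
  have qin: "q (a j) j \<in> block t a (a j)" if "j \<in> {1..t}" for j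
    using bij_betw_apply[OF assms(1)] val[OF that] by blast
  have ag: "glue t a q j \<in> {1..t}" "a (glue t a q j) = a j" if "j \<in> {1..t}" for j
    using qin[OF that] that by (auto simp: eq block_def)
  have "glue t a q permutes {1..t}"
  proof (rule bij_imp_permutes)
    have "inj_on (glue t a q) {1..t}"
    proof (rule inj_onI)
      fix j k assume jk: "j \<in> {1..t}" "k \<in> {1..t}" "glue t a q j = glue t a q k"
      then have ajk: "a j = a k" using ag(2) by metis
      have "inj_on (q (a k)) (block t a (a k))"
        using assms(1) val[OF jk(2)] by (auto simp: bij_betw_def)
      moreover have "q (a k) j = q (a k) k" using jk by (simp add: eq ajk)
      moreover have "j \<in> block t a (a k)" "k \<in> block t a (a k)"
        using val[OF jk(1)] val[OF jk(2)] ajk by auto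
      ultimately show "j = k" by (meson inj_onD)
    qed
    moreover have "glue t a q ` {1..t} \<subseteq> {1..t}" using ag(1) by blast
    ultimately show "bij_betw (glue t a q) {1..t} {1..t}" by (simp add: bij_betw_def endo_inj_surj)
    show "glue t a q j = j" if "j \<notin> {1..t}" for j using that by (auto simp: glue_def)
  qed
  then show "(glue t a q, {}) \<in> S_plus t a"
    using S_plus_iff[of t a "glue t a q" "{}"] assms(2-4) ag(2) by blast
qed

lemma S_plus_bij_betw_block:
  assumes "(p, N) \<in> S_plus t a" "i \<in> {1..a t}"
  shows "bij_betw p (block t a i) (block t a i)"
proof -
  have "p permutes {1..t}" "p ` block t a i = block t a i"
    using assms by (auto simp: S_plus_def)
  then show ?thesis using permutes_inj_on by (auto simp: bij_betw_def)
qed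

text \<open>Gluing is a bijection between families of permutations of the blocks and \<open>S_plus\<close>;
  \<open>Q\<close> selects the admissible restrictions.\<close>

lemma card_S_plus_restrict:
  assumes "1 \<le> t" "\<And>j. j \<in> {1..t} \<Longrightarrow> 0 < a j" "mono_on {1..t} a"
    and cong: "\<And>i f g. i \<in> {1..a t} \<Longrightarrow> bij_betw f (block t a i) (block t a i) \<Longrightarrow>
      (\<And>j. j \<in> block t a i \<Longrightarrow> g j = f j) \<Longrightarrow> Q i g = Q i f"
  shows "card {v \<in> S_plus t a. \<forall>i\<in>{1..a t}. Q i (fst v)} =
    (\<Prod>i=1..a t. card {q. q permutes block t a i \<and> Q i q})"
proof -
  have val: "a j \<in> {1..a t} \<and> j \<in> block t a (a j)" if "j \<in> {1..t}" for j
    by (rule block_value) (use assms(1-3) that in auto)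
  let ?P = "\<Pi>\<^sub>E i\<in>{1..a t}. {q. q permutes block t a i \<and> Q i q}"
  let ?S = "{v \<in> S_plus t a. \<forall>i\<in>{1..a t}. Q i (fst v)}"
  have "bij_betw (\<lambda>q. (glue t a q, {})) ?P ?S"
  proof (rule bij_betw_byWitness[where f' =
      "\<lambda>v. \<lambda>i\<in>{1..a t}. perm_restrict (fst v) (block t a i)"])
    have glue_block: "glue t a q j = q i j" if "j \<in> block t a i" for q i j
      using that by (auto simp: glue_def block_def)
    have bijP: "bij_betw (q i) (block t a i) (block t a i)" if "q \<in> ?P" "i \<in> {1..a t}" for q i
      using that by (auto simp: PiE_iff intro: permutes_imp_bij)
    show "\<forall>q\<in>?P. (\<lambda>i\<in>{1..a t}. perm_restrict (fst (glue t a q, {} :: nat set)) (block t a i)) = q"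
    proof
      fix q assume q: "q \<in> ?P"
      have "perm_restrict (glue t a q) (block t a i) = q i" if "i \<in> {1..a t}" for i
      proof
        fix j
        have "q i permutes block t a i" using q that by (auto simp: PiE_iff)
        then show "perm_restrict (glue t a q) (block t a i) j = q i j"
          by (auto simp: perm_restrict_def glue_block permutes_not_in)
      qed
      then show "(\<lambda>i\<in>{1..a t}. perm_restrict (fst (glue t a q, {} :: nat set)) (block t a i)) = q"
        using q by (auto simp: PiE_iff extensional_def fun_eq_iff)
    qed
    show "\<forall>v\<in>?S. (glue t a (\<lambda>i\<in>{1..a t}. perm_restrict (fst v) (block t a i)), {}) = v"
    proof
      fix v assume v: "v \<in> ?S"
      obtain p where p: "v = (p, {})" "p permutes {1..t}" using v by (auto simp: S_plus_def)
      have "glue t a (\<lambda>i\<in>{1..a t}. perm_restrict p (block t a i)) j = p j" for j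
      proof (cases "j \<in> {1..t}")
        case True
        then show ?thesis using val[OF True] by (simp add: glue_def perm_restrict_def)
      next
        case False
        then show ?thesis using permutes_not_in[OF p(2) False] by (auto simp: glue_def)
      qed
      then show "(glue t a (\<lambda>i\<in>{1..a t}. perm_restrict (fst v) (block t a i)), {}) = v"
        by (simp add: p(1) fun_eq_iff)
    qed
    show "(\<lambda>q. (glue t a q, {})) ` ?P \<subseteq> ?S"
    proof (rule image_subsetI)
      fix q assume q: "q \<in> ?P"
      have "Q i (glue t a q)" if "i \<in> {1..a t}" for i
      proof -
        \<comment> \<open>The glued map agrees with \<open>q i\<close> only on block i, so
          \<open>Q i\<close> must look at nothing but the values there; this is what
          \<open>cong\<close> grants.\<close>
        have "Q i (glue t a q) = Q i (q i)"
          by (rule cong[of i "q i" "glue t a q"])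
            (simp_all only: that bijP[OF q that] glue_block)
        then show ?thesis using q that by (auto simp: PiE_iff)
      qed
      moreover have "(glue t a q, {}) \<in> S_plus t a"
        by (rule glue_in_S_plus(1)) (use bijP[OF q] assms(1-3) in auto)
      ultimately show "(glue t a q, {}) \<in> ?S" by simp
    qed
    show "(\<lambda>v. \<lambda>i\<in>{1..a t}. perm_restrict (fst v) (block t a i)) ` ?S \<subseteq> ?P"
    proof (rule image_subsetI, rule PiE_I)
      fix v i assume v: "v \<in> ?S" and i: "i \<in> {1..a t}"
      have b: "bij_betw (fst v) (block t a i) (block t a i)"
        using v i by (intro S_plus_bij_betw_block[of "fst v" "snd v"]) auto
      have "Q i (perm_restrict (fst v) (block t a i)) = Q i (fst v)"
        by (rule cong[of i "fst v" "perm_restrict (fst v) (block t a i)"])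
          (simp_all only: i b perm_restrict_simps)
      then show "(\<lambda>i\<in>{1..a t}. perm_restrict (fst v) (block t a i)) i \<in> {q. q permutes block t a i \<and> Q i q}"
        using v i perm_restrict_permutes[OF b] by simp
    qed auto
  qed
  then have "card ?S = card ?P" by (rule bij_betw_same_card[symmetric])
  also have "\<dots> = (\<Prod>i=1..a t. card {q. q permutes block t a i \<and> Q i q})"
    by (simp add: card_PiE)
  finally show ?thesis .
qed

lemma card_S_plus:
  assumes "1 \<le> t" "\<And>j. j \<in> {1..t} \<Longrightarrow> 0 < a j" "mono_on {1..t} a"
  shows "card (S_plus t a) = (\<Prod>i=1..a t. fact (type_of t a i))"
proof -
  have "card {v \<in> S_plus t a. \<forall>i\<in>{1..a t}. True} =
      (\<Prod>i=1..a t. card {q. q permutes block t a i \<and> True})"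
    by (rule card_S_plus_restrict[of t a "\<lambda>_ _. True"]) (use assms in auto)
  then have "card (S_plus t a) = (\<Prod>i=1..a t. card {q. q permutes block t a i})"
    by simp
  also have "\<dots> = (\<Prod>i=1..a t. fact (type_of t a i))"
    by (simp add: card_permutations finite_block type_of_def)
  finally show ?thesis .
qed

text \<open>The blocks are independent, so the counts for single blocks multiply. The product form
  avoids division in the natural numbers.\<close>

lemma card_S_plus_has_type:
  assumes "1 \<le> t" "\<And>j. j \<in> {1..t} \<Longrightarrow> 0 < a j" "mono_on {1..t} a"
    and \<mu>: "\<mu> \<in> (\<Pi>\<^sub>E i\<in>{1..a t}. partitions_of (type_of t a i))"
  shows "card {v \<in> S_plus t a. has_type t a v \<mu>} * (\<Prod>i=1..a t. z_partition (\<mu> i)) = card (S_plus t a)"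
proof -
  have "card {v \<in> S_plus t a. has_type t a v \<mu>} =
      (\<Prod>i=1..a t. card {q. q permutes block t a i \<and> cycle_type q (block t a i) = \<mu> i})"
    unfolding has_type_def
  proof (rule card_S_plus_restrict[of t a "\<lambda>i q. cycle_type q (block t a i) = \<mu> i"])
    fix i f g
    assume "bij_betw f (block t a i) (block t a i)" "\<And>j. j \<in> block t a i \<Longrightarrow> g j = f j"
    then have "cycle_type g (block t a i) = cycle_type f (block t a i)"
      by (rule cycle_type_cong[OF _ finite_block])
    then show "(cycle_type g (block t a i) = \<mu> i) = (cycle_type f (block t a i) = \<mu> i)" by simp
  qed (use assms in auto)
  then have "card {v \<in> S_plus t a. has_type t a v \<mu>} * (\<Prod>i=1..a t. z_partition (\<mu> i)) =
      (\<Prod>i=1..a t. card {q. q permutes block t a i \<and> cycle_type q (block t a i) = \<mu> i} * z_partition (\<mu> i))"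
    by (simp add: prod.distrib)
  also have "\<dots> = (\<Prod>i=1..a t. fact (type_of t a i))"
  proof (rule prod.cong[OF refl])
    fix i assume "i \<in> {1..a t}"
    then have "\<mu> i \<in> partitions_of (card (block t a i))"
      using \<mu> by (auto simp: type_of_def PiE_iff)
    then show "card {q. q permutes block t a i \<and> cycle_type q (block t a i) = \<mu> i} * z_partition (\<mu> i) =
        fact (type_of t a i)"
      unfolding type_of_def by (rule card_permutes_cycle_type[OF finite_block])
  qed
  also have "\<dots> = card (S_plus t a)"
    by (rule card_S_plus[symmetric]) (use assms in auto)
  finally show ?thesis .
qed

text \<open>Conjugating maps on the single blocks glue to one s in S_\<alpha>, which itself acts on
  V_t(H) and conjugates the two actions there. The common sign set N covers the positive and the
  negative case at once.\<close>

lemma f_perm_eq_of_has_type: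
  assumes "1 \<le> t" "\<And>j. j \<in> {1..t} \<Longrightarrow> 0 < a j" "mono_on {1..t} a"
    and v: "(p, N) \<in> block_group t a b" "has_type t a (p, N) \<mu>"
    and w: "(q, N) \<in> block_group t a b" "has_type t a (q, N) \<mu>"
  defines "X \<equiv> hyperplane_of t t a b \<inter> cube_vertices t"
  shows "f_perm t X (p, N) = f_perm t X (q, N)"
proof -
  have pq: "(p, {}) \<in> S_plus t a" "(q, {}) \<in> S_plus t a"
    using v(1) w(1) by (auto simp: block_group_def S_minus_def S_plus_def split: if_splits)
  have p: "p permutes {1..t}" and ap: "\<And>j. j \<in> {1..t} \<Longrightarrow> a (p j) = a j"
    using pq(1) S_plus_iff[of t a p "{}"] assms(1-3) by blast+
  have q: "q permutes {1..t}"
    using pq(2) S_plus_iff[of t a q "{}"] assms(1-3) by blast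
  have val: "a j \<in> {1..a t} \<and> j \<in> block t a (a j)" if "j \<in> {1..t}" for j
    by (rule block_value) (use assms(1-3) that in auto)
  have "\<exists>h. bij_betw h (block t a i) (block t a i) \<and> (\<forall>x\<in>block t a i. h (p x) = q (h x))"
    if i: "i \<in> {1..a t}" for i
  proof (rule conj_of_cycle_type_eq)
    show "bij_betw p (block t a i) (block t a i)" "bij_betw q (block t a i) (block t a i)"
      using S_plus_bij_betw_block[OF pq(1) i] S_plus_bij_betw_block[OF pq(2) i] by blast+
    show "cycle_type p (block t a i) = cycle_type q (block t a i)"
      using v(2) w(2) i by (simp add: has_type_def)
  qed (simp_all add: finite_block)
  then obtain h where h: "\<And>i. i \<in> {1..a t} \<Longrightarrow> bij_betw (h i) (block t a i) (block t a i)"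
      "\<And>i x. i \<in> {1..a t} \<Longrightarrow> x \<in> block t a i \<Longrightarrow> h i (p x) = q (h i x)"
    by metis
  define s where "s = glue t a h"
  have s: "(s, {}) \<in> S_plus t a" "\<And>j. j \<in> {1..t} \<Longrightarrow> s j = h (a j) j"
    unfolding s_def using glue_in_S_plus[of a t h, OF h(1) assms(1-3)] by blast+
  have sp: "s permutes {1..t}" using s(1) S_plus_iff[of t a s "{}"] assms(1-3) by blast
  have conj: "s (p j) = q (s j)" if j: "j \<in> {1..t}" for j
  proof -
    have "p j \<in> {1..t}" using permutes_in_image[OF p] j by blast
    then have "s (p j) = h (a j) (p j)" using s(2)[of "p j"] ap[OF j] by simp
    also have "\<dots> = q (h (a j) j)" using h(2) val[OF j] by blast
    finally show ?thesis using s(2)[OF j] by simp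
  qed
  have bij: "bij_betw (act t (r, M)) X X" if "(r, M) \<in> block_group t a b" for r M
    unfolding X_def by (rule bij_betw_act_block_group) (use assms(1-3) that in auto)
  have "cycle_type (act t (p, N)) X = cycle_type (act t (q, N)) X"
  proof (rule cycle_type_conj[of _ _ "act t (s, {})"])
    show "bij_betw (act t (q, N)) X X" by (rule bij[OF w(1)])
    show "bij_betw (act t (s, {})) X X" by (rule bij) (simp add: block_group_def s(1))
    show "finite X" by (simp add: X_def finite_cube_vertices)
    \<comment> \<open>The action reverses composition: applying \<open>act\<close> for s and then
      for p reads the coordinate s (p j). The relation s \<circ> p = q \<circ> s therefore appears
      with q acting before s. The signs match because s has none and N is empty or all of
      {1..t}.\<close>
    show "act t (p, N) (act t (s, {}) x) = act t (s, {}) (act t (q, N) x)" for x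
    proof
      fix j
      show "act t (p, N) (act t (s, {}) x) j = act t (s, {}) (act t (q, N) x) j"
      proof (cases "j \<in> {1..t}")
        case True
        have "N = {} \<or> N = {1..t}"
          using v(1) by (auto simp: block_group_def S_minus_def S_plus_def split: if_splits)
        moreover have "p j \<in> {1..t}" "s j \<in> {1..t}"
          using permutes_in_image[OF p] permutes_in_image[OF sp] True by blast+
        ultimately show ?thesis using True conj[OF True] by (auto simp: act_def)
      next
        case False
        then show ?thesis by (auto simp: act_def)
      qed
    qed
  qed
  then show ?thesis by (simp add: f_perm_def num_cycles_def fun_eq_iff)
qed

text \<open>Collects elements of equal type. The function \<phi> is left general since the negative
  elements are also summed over \<open>S_plus\<close>, with all signs switched inside
  \<phi>.\<close>

lemma sum_S_plus_by_type:
  fixes \<phi> :: "signed_perm \<Rightarrow> zpoly"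
  assumes "1 \<le> t" "\<And>j. j \<in> {1..t} \<Longrightarrow> 0 < a j" "mono_on {1..t} a"
  defines "M \<equiv> \<Pi>\<^sub>E i\<in>{1..a t}. partitions_of (type_of t a i)"
  assumes \<phi>: "\<And>v \<mu>. v \<in> S_plus t a \<Longrightarrow> has_type t a v \<mu> \<Longrightarrow> \<phi> v = F \<mu>"
  shows "(\<Sum>v\<in>S_plus t a. \<phi> v) = zconst (of_nat (card (S_plus t a))) *
    (\<Sum>\<mu>\<in>M. zconst (\<Prod>i=1..a t. inverse (of_nat (z_partition (\<mu> i)))) * F \<mu>)"
proof -
  \<comment> \<open>The restriction makes \<tau> v extensional like the members of M, so having type
    \<mu> becomes an equality of functions and the sum can be grouped by it.\<close>
  define \<tau> where "\<tau> v = (\<lambda>i\<in>{1..a t}. cycle_type (fst v) (block t a i))" for v :: signed_perm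
  have finM: "finite M" unfolding M_def by (intro finite_PiE finite_partitions_of) auto
  have finS: "finite (S_plus t a)" using S_plus_subset finite_signed_perms by (rule finite_subset)
  have \<tau>: "\<tau> v = \<mu> \<longleftrightarrow> has_type t a v \<mu>" if "\<mu> \<in> M" for v \<mu>
    using that by (auto simp: \<tau>_def has_type_def M_def PiE_iff extensional_def fun_eq_iff)
  have "\<tau> ` S_plus t a \<subseteq> M"
  proof (rule image_subsetI)
    fix v assume v: "v \<in> S_plus t a"
    have "cycle_type (fst v) (block t a i) \<in> partitions_of (type_of t a i)" if "i \<in> {1..a t}" for i
      unfolding type_of_def
      using S_plus_bij_betw_block[of "fst v" "snd v"] v that
      by (intro cycle_type_in_partitions_of finite_block) auto
    then show "\<tau> v \<in> M" by (simp add: \<tau>_def M_def)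
  qed
  then have "(\<Sum>v\<in>S_plus t a. \<phi> v) = (\<Sum>\<mu>\<in>M. \<Sum>v\<in>{v \<in> S_plus t a. \<tau> v = \<mu>}. \<phi> v)"
    using finS finM by (intro sum.group[symmetric])
  also have "\<dots> = (\<Sum>\<mu>\<in>M. zconst (of_nat (card (S_plus t a))) *
      (zconst (\<Prod>i=1..a t. inverse (of_nat (z_partition (\<mu> i)))) * F \<mu>))"
  proof (rule sum.cong[OF refl])
    fix \<mu> assume \<mu>: "\<mu> \<in> M"
    let ?K = "{v \<in> S_plus t a. has_type t a v \<mu>}"
    let ?z = "\<Prod>i=1..a t. z_partition (\<mu> i)"
    have "0 < ?z"
      using \<mu> by (intro prod_pos z_partition_pos) (auto simp: M_def PiE_iff partitions_of_def)
    moreover have "card ?K * ?z = card (S_plus t a)"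
      by (rule card_S_plus_has_type) (use assms(1-3) \<mu> in \<open>simp_all only: M_def\<close>)
    then have "(of_nat (card (S_plus t a)) :: rat) = of_nat (card ?K) * of_nat ?z"
      by (simp only: of_nat_mult[symmetric])
    ultimately have "(of_nat (card ?K) :: rat) = of_nat (card (S_plus t a)) * inverse (of_nat ?z)"
      by (simp add: field_simps del: of_nat_prod)
    also have "inverse (of_nat ?z :: rat) = (\<Prod>i=1..a t. inverse (of_nat (z_partition (\<mu> i))))"
      by (simp only: of_nat_prod prod_inversef[symmetric] comp_def)
    finally have card: "(of_nat (card ?K) :: zpoly) = zconst (of_nat (card (S_plus t a))) *
        zconst (\<Prod>i=1..a t. inverse (of_nat (z_partition (\<mu> i))))"
      by (simp only: zconst_mult[symmetric] zconst_of_nat[symmetric])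
    have "(\<Sum>v\<in>{v \<in> S_plus t a. \<tau> v = \<mu>}. \<phi> v) = (\<Sum>v\<in>?K. F \<mu>)"
      using \<tau>[OF \<mu>] \<phi> by (intro sum.cong) auto
    then show "(\<Sum>v\<in>{v \<in> S_plus t a. \<tau> v = \<mu>}. \<phi> v) = zconst (of_nat (card (S_plus t a))) *
      (zconst (\<Prod>i=1..a t. inverse (of_nat (z_partition (\<mu> i)))) * F \<mu>)"
      by (simp only: sum_constant card mult.assoc)
  qed
  finally show ?thesis by (simp only: sum_distrib_left)
qed

text \<open>The tuples of partitions are extensional functions on {1..a t}, so each tuple is counted
  once.\<close>

theorem theorem6p3:
  fixes n t b :: nat and a :: "nat \<Rightarrow> nat" and H :: "(nat \<Rightarrow> real) set"
  assumes "1 \<le> t" and "t \<le> n"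
    and "\<And>j. j \<in> {1..t} \<Longrightarrow> 0 < a j" and "0 < b"
    and "mono_on {1..t} a"
    and "H = hyperplane_of n t a b"
    and "spanned_hyperplane n H"
  shows "cycle_index (hyperplane_stabilizer n H) (act n) (H \<inter> cube_vertices n) =
    zconst (1 / 2 ^ hyperplane_delta t a b) *
    (\<Sum>\<mu>\<in>(\<Pi>\<^sub>E i\<in>{1..a t}. partitions_of (type_of t a i)).
       zconst (\<Prod>i=1..a t. inverse (of_nat (z_partition (\<mu> i)))) *
       (zsubst (cube_cycle_index (n - t)) (f_plus t a b \<mu>) +
        (if hyperplane_delta t a b = 1
         then zsubst (cube_cycle_index (n - t)) (f_minus t a b \<mu>) else 0)))"
proof -
  define X where "X = hyperplane_of t t a b \<inter> cube_vertices t"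
  define G where "G = zsubst (cube_cycle_index (n - t))"
  define M where "M = (\<Pi>\<^sub>E i\<in>{1..a t}. partitions_of (type_of t a i))"
  define c where "c \<mu> = zconst (\<Prod>i=1..a t. inverse (of_nat (z_partition (\<mu> i))))" for \<mu>
  let ?P = "S_plus t a" and ?N = "S_minus t a" and ?B = "block_group t a b"
  let ?\<delta> = "hyperplane_delta t a b"
  have "finite ?P" using S_plus_subset finite_signed_perms by (rule finite_subset)
  moreover have "(id, {}) \<in> ?P" by (simp add: S_plus_def permutes_id)
  ultimately have card_pos: "0 < card ?P" by (auto simp: card_gt_0_iff)
  \<comment> \<open>The element v itself shows that the choice behind \<open>f_plus\<close> is made
    from a nonempty set, so the chosen w has type \<mu> and is comparable with v.\<close>
  have plus: "f_perm t X v = f_plus t a b \<mu>" if v: "v \<in> ?P" "has_type t a v \<mu>" for v \<mu>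
  proof -
    define w where "w = (SOME w. w \<in> ?P \<and> has_type t a w \<mu>)"
    have w: "w \<in> ?P \<and> has_type t a w \<mu>" unfolding w_def by (rule someI[of _ v]) (use v in blast)
    obtain p q where vw: "v = (p, {})" "w = (q, {})" using v(1) w by (auto simp: S_plus_def)
    have "f_perm t X v = f_perm t X w"
      unfolding X_def vw
      by (rule f_perm_eq_of_has_type[of t a p "{}" b \<mu> q])
        (use assms(1,3,5) v w in \<open>auto simp: vw block_group_def\<close>)
    then show ?thesis by (simp add: f_plus_def X_def w_def)
  qed
  have minus: "f_perm t X (fst v, {1..t}) = f_minus t a b \<mu>"
    if v: "v \<in> ?P" "has_type t a v \<mu>" and d: "?\<delta> = 1" for v \<mu>
  proof -
    define w where "w = (SOME w. w \<in> ?N \<and> has_type t a w \<mu>)"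
    have "v = (fst v, {})" using v(1) by (auto simp: S_plus_def)
    then have v': "(fst v, {1..t}) \<in> ?N" "has_type t a (fst v, {1..t}) \<mu>"
      using v by (auto simp: S_minus_def has_type_def)
    have w: "w \<in> ?N \<and> has_type t a w \<mu>"
      unfolding w_def by (rule someI[of _ "(fst v, {1..t})"]) (use v' in blast)
    obtain q where q: "w = (q, {1..t})" using w by (auto simp: S_minus_def)
    have "f_perm t X (fst v, {1..t}) = f_perm t X w"
      unfolding X_def q
      by (rule f_perm_eq_of_has_type[of t a "fst v" "{1..t}" b \<mu> q])
        (use assms(1,3,5) v' w d in \<open>auto simp: q block_group_def\<close>)
    then show ?thesis by (simp add: f_minus_def X_def w_def)
  qed
  have sumP: "(\<Sum>v\<in>?P. G (f_perm t X v)) = zconst (of_nat (card ?P)) * (\<Sum>\<mu>\<in>M. c \<mu> * G (f_plus t a b \<mu>))"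
    unfolding M_def c_def
    by (rule sum_S_plus_by_type) (use assms(1,3,5) plus in auto)
  have total: "zconst (1 / of_nat (card ?B)) * (\<Sum>v\<in>?B. G (f_perm t X v)) =
      zconst (1 / 2 ^ ?\<delta>) * (\<Sum>\<mu>\<in>M. c \<mu> * (G (f_plus t a b \<mu>) + (if ?\<delta> = 1 then G (f_minus t a b \<mu>) else 0)))"
  proof (cases "?\<delta> = 1")
    case True
    have bij: "bij_betw (\<lambda>v. (fst v, {1..t})) ?P ?N"
      by (rule bij_betw_byWitness[where f' = "\<lambda>v. (fst v, {})"]) (auto simp: S_minus_def S_plus_def)
    \<comment> \<open>The sign sets \<open>{}\<close> and \<open>{1..t}\<close> differ because t is
      at least 1, so P(H) has exactly twice as many elements as S_\<alpha>.\<close>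
    have "?P \<inter> ?N = {}" using assms(1) by (auto simp: S_minus_def S_plus_def)
    moreover have "finite ?N" using S_minus_subset finite_signed_perms by (rule finite_subset)
    moreover have B: "?B = ?P \<union> ?N" using True by (simp add: block_group_def)
    ultimately have cardB: "card ?B = 2 * card ?P"
      and sumB: "(\<Sum>v\<in>?B. G (f_perm t X v)) = (\<Sum>v\<in>?P. G (f_perm t X v)) + (\<Sum>v\<in>?N. G (f_perm t X v))"
      using \<open>finite ?P\<close> bij_betw_same_card[OF bij]
      by (simp_all add: card_Un_disjoint sum.union_disjoint)
    have "(\<Sum>v\<in>?N. G (f_perm t X v)) = (\<Sum>v\<in>?P. G (f_perm t X (fst v, {1..t})))"
      by (rule sum.reindex_bij_betw[OF bij, symmetric])
    also have "\<dots> = zconst (of_nat (card ?P)) * (\<Sum>\<mu>\<in>M. c \<mu> * G (f_minus t a b \<mu>))"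
      unfolding M_def c_def
      by (rule sum_S_plus_by_type) (use assms(1,3,5) minus True in auto)
    finally have "(\<Sum>v\<in>?B. G (f_perm t X v)) = zconst (of_nat (card ?P)) *
        (\<Sum>\<mu>\<in>M. c \<mu> * (G (f_plus t a b \<mu>) + G (f_minus t a b \<mu>)))"
      unfolding sumB sumP by (simp only: distrib_left sum.distrib)
    \<comment> \<open>The order of S_\<alpha> cancels and only the factor 1/2 from the two signs
      survives.\<close>
    moreover have "zconst (1 / of_nat (card ?B)) * zconst (of_nat (card ?P)) = zconst (1 / 2 ^ ?\<delta>)"
      using card_pos True by (simp add: cardB flip: zconst_mult)
    ultimately show ?thesis using True by (simp only: mult.assoc[symmetric] if_True simp_thms)
  next
    case False
    then have "?B = ?P" "?\<delta> = 0"
      by (auto simp: block_group_def hyperplane_delta_def split: if_splits)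
    moreover have "zconst (1 / of_nat (card ?P)) * zconst (of_nat (card ?P)) = zconst 1"
      using card_pos by (simp flip: zconst_mult)
    ultimately show ?thesis
      using sumP by (simp add: zconst_1 mult.assoc[symmetric])
  qed
  have "cycle_index (hyperplane_stabilizer n H) (act n) (H \<inter> cube_vertices n) =
      zconst (1 / of_nat (card ?B)) * (\<Sum>v\<in>?B. G (f_perm t X v))"
    unfolding assms(6) X_def G_def by (rule cycle_index_stabilizer[OF assms(1-3,5)])
  also note total
  finally show ?thesis unfolding G_def M_def c_def .
qed

end
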